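(* Let $N\ge 2$, $k=\frac{N(N-1)}{2}$, and consider an $N$-Higgs-doublet potential written in bilinear form $$V=M_0K_0+M_aK_a+\Lambda_0K_0^2+L_aK_0K_a+\Lambda_{ab}K_aK_b$$ (summation over $a,b=1,\dots,N^2-1$), with $M_0,\Lambda_0\in\mathbb{R}$, $L,M\in\mathbb{R}^{N^2-1}$ and $\Lambda$ a real symmetric $(N^2-1)\times(N^2-1)$ matrix. Then $V$ admits a $CP2$ symmetry if and only if the following two conditions both hold: (i) there exist $k$ linearly independent eigenvectors $v_1,\dots,v_k\in\mathbb{R}^{N^2-1}$ of $\Lambda$ such that, writing $V_a=\sum_{i=1}^{N^2-1}(v_a)_i\lambda_i$, the real linear span $\mathcal{W}=\mathrm{span}_{\mathbb{R}}\{V_1,\dots,V_k\}$ forms a basis of (a Hermitian-matrix realization of) the defining representation of $\mathfrak{so}(N)$, i.e. $\mathcal{W}$ is closed under $(A,B)\mapsto -i[A,B]$ and there exists an invertible $S\in GL(N,\mathbb{C})$ with $S\,\mathcal{W}\,S^{-1}=\mathrm{span}_{\mathbb{R}}\{\lambda_1,\dots,\lambda_k\}=\{iA: A \text{ a real antisymmetric } N\times N \text{ matrix}\}$; (ii) $L\cdot v_a=M\cdot v_a=0$ for all $a\in\{1,\dots,k\}$.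
   Context: The model has $N$ Higgs $\mathsf{SU}(2)$ doublets $\Phi_1,\dots,\Phi_N$. The bilinears are $K_0=\Phi_i^\dagger\Phi_i$ and $K_a=\Phi_i^\dagger(\lambda_a)_{ij}\Phi_j$, $a=1,\dots,N^2-1$, where $\lambda_a$ are the generalized Gell-Mann matrices: Hermitian traceless $N\times N$ matrices with $\mathrm{Tr}(\lambda_a\lambda_b)=2\delta_{ab}$, $[\lambda_a,\lambda_b]=2if_{abc}\lambda_c$, ordered so that $\lambda_1,\dots,\lambda_k$ are the antisymmetric (purely imaginary) ones and $\lambda_{k+1},\dots,\lambda_{N^2-1}$ are the symmetric (real) ones. A change of doublet basis $\Phi_i\to U_{ij}\Phi_j$, $U\in\mathsf{SU}(N)$, leaves $K_0$ invariant and sends $K_a\to R_{ab}(U)K_b$ with $R_{ab}(U)=\frac12\mathrm{Tr}(U^\dagger\lambda_aU\lambda_b)$; correspondingly $L\to R(U)L$, $M\to R(U)M$, $\Lambda\to R(U)\Lambda R(U)^T$. A general $CP$ transformation is $\Phi_i(\vec x,t)\to V_{ij}\Phi_j^*(-\vec x,t)$ with $V\in\mathsf{U}(N)$; the potential admits a $CP2$ symmetry if it is invariant under such a transformation which is of order 2 (applying it twice gives the identity). It is known that a $CP2$ symmetry exists if and only if there is a doublet basis in which all coefficients of the potential are real, i.e. a basis in which $\Lambda_{ab}=0$ whenever $a\le k<b$ (so $\Lambda$ is block diagonal with respect to antisymmetric/symmetric generators) and $L_a=M_a=0$ for all $a\le k$. *)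

theory Defs
  imports "HOL-Analysis.Analysis"
begin

text \<open>Matrices are N x N complex matrices indexed by a finite type 'n with CARD('n) = N.
  Generator indices a are natural numbers, 0-based: a < N^2-1; the first k = N(N-1)/2
  generators (a < k) are the antisymmetric (purely imaginary) ones.\<close>

definition nG :: "'n::finite itself \<Rightarrow> nat" where
  "nG _ = CARD('n)^2 - 1"

definition nK :: "'n::finite itself \<Rightarrow> nat" where
  "nK _ = CARD('n) * (CARD('n) - 1) div 2"

definition hermitian_mat :: "complex^'n^'n \<Rightarrow> bool" where
  "hermitian_mat A \<longleftrightarrow> (\<forall>i j. A$i$j = cnj (A$j$i))"

definition mtrace :: "complex^'n^'n \<Rightarrow> complex" where
  "mtrace A = (\<Sum>i\<in>UNIV. A$i$i)"

definition adjoint_mat :: "complex^'n^'n \<Rightarrow> complex^'n^'n" where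
  "adjoint_mat A = (\<chi> i j. cnj (A$j$i))"

definition unitary_mat :: "complex^'n^'n \<Rightarrow> bool" where
  "unitary_mat U \<longleftrightarrow> U ** adjoint_mat U = mat 1 \<and> adjoint_mat U ** U = mat 1"

definition gell_mann :: "(nat \<Rightarrow> complex^'n::finite^'n) \<Rightarrow> bool" where
  "gell_mann lam \<longleftrightarrow>
     (\<forall>a < nG TYPE('n). hermitian_mat (lam a) \<and> mtrace (lam a) = 0) \<and>
     (\<forall>a < nG TYPE('n). \<forall>b < nG TYPE('n).
         mtrace (lam a ** lam b) = (if a = b then 2 else 0)) \<and>
     (\<forall>a < nK TYPE('n). \<forall>i j. Re (lam a $ i $ j) = 0) \<and>
     (\<forall>a. nK TYPE('n) \<le> a \<and> a < nG TYPE('n) \<longrightarrow> (\<forall>i j. Im (lam a $ i $ j) = 0))"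

text \<open>Doublets: Phi $ i is the i-th SU(2) doublet (a vector in C^2).\<close>
definition dinner :: "complex^2 \<Rightarrow> complex^2 \<Rightarrow> complex" where
  "dinner x y = (\<Sum>\<alpha>\<in>UNIV. cnj (x$\<alpha>) * y$\<alpha>)"

definition K0 :: "complex^2^'n::finite \<Rightarrow> real" where
  "K0 Phi = Re (\<Sum>i\<in>UNIV. dinner (Phi$i) (Phi$i))"

definition Kbil :: "(nat \<Rightarrow> complex^'n^'n) \<Rightarrow> nat \<Rightarrow> complex^2^'n::finite \<Rightarrow> real" where
  "Kbil lam a Phi = Re (\<Sum>i\<in>UNIV. \<Sum>j\<in>UNIV. dinner (Phi$i) (Phi$j) * lam a $ i $ j)"

definition potential ::
  "(nat \<Rightarrow> complex^'n^'n) \<Rightarrow> real \<Rightarrow> (nat \<Rightarrow> real) \<Rightarrow> real \<Rightarrow> (nat \<Rightarrow> real)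
     \<Rightarrow> (nat \<Rightarrow> nat \<Rightarrow> real) \<Rightarrow> complex^2^'n::finite \<Rightarrow> real" where
  "potential lam M0 M Lam0 L Lam Phi =
     M0 * K0 Phi + (\<Sum>a<nG TYPE('n). M a * Kbil lam a Phi)
     + Lam0 * (K0 Phi)^2 + (\<Sum>a<nG TYPE('n). L a * K0 Phi * Kbil lam a Phi)
     + (\<Sum>a<nG TYPE('n). \<Sum>b<nG TYPE('n). Lam a b * Kbil lam a Phi * Kbil lam b Phi)"

text \<open>General CP transformation Phi_i -> U_ij Phi_j^* (spatial argument irrelevant for V).\<close>
definition cp_trafo :: "complex^'n^'n \<Rightarrow> complex^2^'n::finite \<Rightarrow> complex^2^'n" where
  "cp_trafo U Phi = (\<chi> i \<alpha>. \<Sum>j\<in>UNIV. U$i$j * cnj (Phi$j$\<alpha>))"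

definition has_CP2 ::
  "(nat \<Rightarrow> complex^'n^'n) \<Rightarrow> real \<Rightarrow> (nat \<Rightarrow> real) \<Rightarrow> real \<Rightarrow> (nat \<Rightarrow> real)
     \<Rightarrow> (nat \<Rightarrow> nat \<Rightarrow> real) \<Rightarrow> bool" where
  "has_CP2 lam M0 M Lam0 L Lam \<longleftrightarrow>
     (\<exists>U::complex^'n::finite^'n. unitary_mat U \<and>
        (\<forall>Phi. cp_trafo U (cp_trafo U Phi) = Phi) \<and>
        (\<forall>Phi. potential lam M0 M Lam0 L Lam (cp_trafo U Phi)
               = potential lam M0 M Lam0 L Lam Phi))"

definition mcomm_i :: "complex^'n^'n \<Rightarrow> complex^'n^'n \<Rightarrow> complex^'n^'n" where
  "mcomm_i A B = (\<chi> i j. (- \<i>) * (A ** B - B ** A) $ i $ j)"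

definition so_herm :: "(complex^'n::finite^'n) set" where
  "so_herm = {(\<chi> i j. \<i> * complex_of_real (A$i$j)) | A :: real^'n^'n. transpose A = - A}"

end

theory Submission
  imports Defs
begin

text \<open>
  Collect the doublets into the Hermitian matrix \<open>P = \<Phi> \<Phi>\<^sup>\<dagger>\<close>. Every bilinear is then a real inner product
  \<open>K\<^sub>a = \<langle>\<lambda>\<^sub>a, P\<rangle> = Re Tr (\<lambda>\<^sub>a P)\<close>, and the CP transformation with matrix U acts as the reflection
  \<open>\<sigma>(A) = U A\<^sup>* U\<^sup>\<dagger>\<close>; it is of order 2 iff \<open>U U\<^sup>* = 1\<close>. Since the matrices \<open>x x\<^sup>\<dagger>\<close> span the Hermitian matrices,
  V is invariant iff \<open>\<Lambda>\<close> preserves the odd space \<open>{A. \<sigma>(A) = - A}\<close> and L, M are orthogonal to it. Choosing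
  T unitary with \<open>U T\<^sup>* = T\<close>, the odd space is \<open>T so(N) T\<^sup>\<dagger>\<close>, hence of dimension k, and the spectral theorem
  for \<open>\<Lambda>\<close> on it yields the eigenvectors.

  Conversely, if \<open>W\<close> consists of Hermitian matrices and \<open>S W S\<^sup>-\<^sup>1 = so(N)\<close>, then \<open>S S\<^sup>\<dagger>\<close> commutes with \<open>so(N)\<close>.
  For \<open>N \<ge> 3\<close> it is therefore scalar, and \<open>W\<close> is the odd space of \<open>U = S\<^sup>-\<^sup>1 S\<^sup>*\<close>; for \<open>N = 2\<close> a suitable U
  can be written down.
\<close>

subsection \<open>Self-adjoint operators and real structures\<close>

text \<open>The Rayleigh quotient attains its maximum on the compact unit sphere of
  \<open>W\<close>. At a maximiser the residual \<open>f x - \<mu> *\<^sub>R x\<close> vanishes,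
  since otherwise moving along it would increase the quotient.\<close>

lemma selfadjoint_eigenvector:
  fixes f :: "'a::euclidean_space \<Rightarrow> 'a"
  assumes f: "linear f" and sa: "\<And>x y. f x \<bullet> y = x \<bullet> f y"
    and W: "subspace W" and inv: "\<And>x. x \<in> W \<Longrightarrow> f x \<in> W" and nz: "W \<noteq> {0}"
  obtains x \<mu> where "x \<in> W" "norm x = 1" "f x = \<mu> *\<^sub>R x"
proof -
  interpret f: linear f by fact
  obtain w where w: "w \<in> W" "w \<noteq> 0" using nz W subspace_0 by blast
  let ?K = "sphere 0 1 \<inter> W"
  have "compact ?K" using W by (intro compact_Int_closed closed_subspace) auto
  moreover have "(1 / norm w) *\<^sub>R w \<in> ?K" using w W by (auto intro: subspace_scale)
  moreover have "continuous_on ?K (\<lambda>x. f x \<bullet> x)"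
    by (intro continuous_intros linear_continuous_on linear_linear[THEN iffD2] f)
  ultimately obtain x where x: "x \<in> ?K" and max: "\<And>y. y \<in> ?K \<Longrightarrow> f y \<bullet> y \<le> f x \<bullet> x"
    using continuous_attains_sup[of ?K "\<lambda>x. f x \<bullet> x"] by blast
  define \<mu> where "\<mu> = f x \<bullet> x"
  \<comment> \<open>By homogeneity, maximality becomes \<open>q y \<ge> 0\<close> on all of
    \<open>W\<close>, with equality at \<open>x\<close>; perturbations of \<open>x\<close> can then
    be tested without normalising them.\<close>
  define q where "q y = \<mu> * (y \<bullet> y) - f y \<bullet> y" for y
  have x1: "x \<bullet> x = 1" using x by (simp add: norm_eq_1)
  have q0: "q y \<ge> 0" if "y \<in> W" for y
  proof (cases "y = 0")
    case False
    have "(1 / norm y) *\<^sub>R y \<in> ?K" using False that W by (auto intro: subspace_scale)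
    from max[OF this] have "(f y \<bullet> y) / (norm y)^2 \<le> \<mu>"
      by (simp add: f.scaleR \<mu>_def power2_eq_square)
    then show ?thesis using False
      by (simp add: q_def field_simps power2_norm_eq_inner)
  qed (simp add: q_def f.zero)
  define h where "h = f x - \<mu> *\<^sub>R x"
  have hW: "h \<in> W" unfolding h_def using x W inv by (auto intro: subspace_diff subspace_scale)
  have key: "2 * (h \<bullet> h) \<le> t * q h" if "t > 0" for t
  proof -
    have "q (x + t *\<^sub>R h) = - 2 * t * (h \<bullet> h) + t^2 * q h"
    proof -
      have 1: "f x \<bullet> h = h \<bullet> h + \<mu> * (x \<bullet> h)" by (simp add: h_def inner_diff_left)
      have "f h \<bullet> x = f x \<bullet> h" by (metis sa inner_commute)
      then show ?thesis unfolding q_def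
        by (simp add: f.add f.scaleR inner_add_left inner_add_right x1 1 \<mu>_def[symmetric]
            algebra_simps power2_eq_square inner_commute[of h x])
    qed
    moreover have "x + t *\<^sub>R h \<in> W" using x hW W by (auto intro: subspace_add subspace_scale)
    ultimately have "0 \<le> t * (- 2 * (h \<bullet> h) + t * q h)" using q0[of "x + t *\<^sub>R h"]
      by (simp add: algebra_simps power2_eq_square)
    then show ?thesis using that by (simp add: zero_le_mult_iff)
  qed
  have "h \<bullet> h \<le> 0"
  proof (cases "q h > 0")
    case True
    show ?thesis
    proof (rule ccontr)
      assume "\<not> h \<bullet> h \<le> 0"
      then have "h \<bullet> h > 0" by linarith
      \<comment> \<open>This \<open>t\<close> turns \<open>key\<close> into
        \<open>2 * (h \<bullet> h) \<le> h \<bullet> h\<close>.\<close>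
      with key[of "(h \<bullet> h) / q h"] True show False by simp
    qed
  next
    case False
    with key[of 1] show ?thesis by simp
  qed
  then have "h = 0" by (simp add: inner_gt_zero_iff not_less[symmetric])
  then show thesis using that[of x \<mu>] x by (simp add: h_def)
qed

lemma selfadjoint_eigenbasis:
  fixes f :: "'a::euclidean_space \<Rightarrow> 'a"
  assumes f: "linear f" and sa: "\<And>x y. f x \<bullet> y = x \<bullet> f y"
    and W: "subspace W" and inv: "\<And>x. x \<in> W \<Longrightarrow> f x \<in> W"
  shows "\<exists>B. B \<subseteq> W \<and> independent B \<and> span B = W \<and> (\<forall>x\<in>B. \<exists>\<mu>. f x = \<mu> *\<^sub>R x)"
proof -
  \<comment> \<open>The induction on dimension carries orthogonality and exclusion of 0 in place of
    independence. A unit eigenvector is split off; its orthogonal complement in \<open>W\<close> is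
    invariant by self-adjointness.\<close>
  have "\<exists>B. B \<subseteq> W \<and> pairwise orthogonal B \<and> 0 \<notin> B \<and> span B = W \<and> (\<forall>x\<in>B. \<exists>\<mu>. f x = \<mu> *\<^sub>R x)"
    using W inv
  proof (induction "dim W" arbitrary: W rule: less_induct)
    case less
    show ?case
    proof (cases "W = {0}")
      case True
      then show ?thesis by (intro exI[of _ "{}"]) auto
    next
      case False
      obtain x \<mu> where x: "x \<in> W" "norm x = 1" "f x = \<mu> *\<^sub>R x"
        using selfadjoint_eigenvector[OF f sa less.prems(1) less.prems(2) False] by blast
      have x1: "x \<bullet> x = 1" using x by (simp add: norm_eq_1)
      let ?W = "{y \<in> W. x \<bullet> y = 0}"
      have sub: "subspace ?W" using less.prems(1)
        by (auto simp: subspace_def inner_add_right)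
      have "dim ?W < dim W"
      proof -
        have "x \<notin> ?W" using x1 by simp
        then have "?W \<subset> W" using x by blast
        then show ?thesis
          using sub less.prems(1) dim_psubset[of ?W W] by (metis span_eq_iff)
      qed
      moreover have "f y \<in> ?W" if "y \<in> ?W" for y
        using that less.prems(2) x by (simp add: sa[symmetric])
      ultimately obtain B where B: "B \<subseteq> ?W" "pairwise orthogonal B" "0 \<notin> B" "span B = ?W"
          "\<forall>x\<in>B. \<exists>\<mu>. f x = \<mu> *\<^sub>R x"
        using less.hyps[OF _ sub] by blast
      have "span (insert x B) = W"
      proof
        show "span (insert x B) \<subseteq> W"
          using x B less.prems(1) by (intro span_minimal) auto
        show "W \<subseteq> span (insert x B)"
        proof
          fix w assume w: "w \<in> W"
          have "w - (x \<bullet> w) *\<^sub>R x \<in> ?W"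
            using w x x1 less.prems(1) by (auto simp: inner_diff_right intro: subspace_diff subspace_scale)
          then show "w \<in> span (insert x B)" using B(4) span_breakdown_eq by blast
        qed
      qed
      moreover have "pairwise orthogonal (insert x B)"
        using B by (auto simp: pairwise_insert orthogonal_def inner_commute)
      moreover have "insert x B \<subseteq> W" "0 \<notin> insert x B" using B(1,3) x x1 by auto
      moreover have "\<forall>y\<in>insert x B. \<exists>\<nu>. f y = \<nu> *\<^sub>R y" using B(5) x(3) by blast
      ultimately show ?thesis by blast
    qed
  qed
  then show ?thesis using pairwise_orthogonal_independent by metis
qed

text \<open>Since \<open>j\<close> anticommutes with the involution \<open>s\<close>, it maps the +1
  eigenspace of \<open>s\<close> isomorphically onto the -1 eigenspace, and the two together fill
  the space. Applied below to the adjoint on matrices and to \<open>x \<mapsto> U x\<^sup>*\<close>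
  on vectors.\<close>

lemma dim_real_structure:
  fixes s j :: "'a::euclidean_space \<Rightarrow> 'a"
  assumes s: "linear s" and j: "linear j"
    and ss: "\<And>x. s (s x) = x" and jj: "\<And>x. j (j x) = - x" and sj: "\<And>x. s (j x) = - j (s x)"
  shows "2 * dim {x. s x = x} = DIM('a)"
proof -
  interpret s: linear s by fact
  interpret j: linear j by fact
  let ?F = "{x. s x = x}"
  have sub: "subspace ?F" by (auto simp: subspace_def s.zero s.add s.scaleR)
  have inj: "inj j" by (metis injI jj minus_equation_iff)
  have "?F \<inter> j ` ?F = {0}"
  proof -
    have "x = 0" if "s x = x" "x = j y" "s y = y" for x y
    proof -
      have "x = - x" using that sj[of y] by simp
      then show ?thesis by (simp add: eq_neg_iff_add_eq_0 flip: scaleR_2)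
    qed
    then show ?thesis by (auto simp: s.zero j.zero image_iff intro!: exI[of _ 0])
  qed
  moreover have "{x + y |x y. x \<in> ?F \<and> y \<in> j ` ?F} = UNIV"
  proof -
    have "x \<in> {x + y |x y. x \<in> ?F \<and> y \<in> j ` ?F}" for x
    proof -
      \<comment> \<open>Chosen so that \<open>j z\<close> is the odd part
        \<open>(x - s x) / 2\<close> of \<open>x\<close>.\<close>
      define z where "z = - j ((1/2) *\<^sub>R (x - s x))"
      have "s z = z" by (simp add: z_def s.neg sj s.scaleR s.diff ss j.scaleR j.diff algebra_simps)
      moreover have "x = (1/2) *\<^sub>R (x + s x) + j z"
        by (simp add: z_def j.neg jj scaleR_add_right scaleR_diff_right flip: scaleR_add_left)
      moreover have "s ((1/2) *\<^sub>R (x + s x)) = (1/2) *\<^sub>R (x + s x)"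
        by (simp add: s.scaleR s.add ss add.commute)
      ultimately show ?thesis by blast
    qed
    then show ?thesis by blast
  qed
  moreover have "dim (j ` ?F) = dim ?F"
    using dim_image_eq[OF j] inj by (meson inj_on_subset subset_UNIV)
  ultimately show ?thesis
    using dim_sums_Int[OF sub linear_subspace_image[OF j sub]] by simp
qed

subsection \<open>Complex matrices as a Euclidean space\<close>

definition conj_mat :: "complex^'n^'n \<Rightarrow> complex^'n^'n" where
  "conj_mat A = (\<chi> i j. cnj (A$i$j))"

definition imul :: "complex^'n^'m \<Rightarrow> complex^'n^'m" where
  "imul A = (\<chi> i j. \<i> * A$i$j)"

lemma conj_mat_nth [simp]: "conj_mat A $ i $ j = cnj (A$i$j)"
  by (simp add: conj_mat_def)

lemma adjoint_mat_nth [simp]: "adjoint_mat A $ i $ j = cnj (A$j$i)"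
  by (simp add: adjoint_mat_def)

lemma imul_nth [simp]: "imul A $ i $ j = \<i> * A$i$j"
  by (simp add: imul_def)

lemma hermitian_mat_iff_adjoint: "hermitian_mat A \<longleftrightarrow> adjoint_mat A = A"
  by (auto simp: hermitian_mat_def vec_eq_iff dest: sym)

lemma linear_conj_mat: "linear conj_mat"
  by (rule linearI) (simp_all add: vec_eq_iff)

lemma linear_adjoint_mat: "linear adjoint_mat"
  by (rule linearI) (simp_all add: vec_eq_iff)

lemma linear_imul: "linear imul"
  by (rule linearI) (simp_all add: vec_eq_iff algebra_simps)

lemma linear_matrix_mult_right: "linear (\<lambda>A::complex^'n^'n. A ** C)"
  by (rule linearI)
    (simp_all add: vec_eq_iff matrix_matrix_mult_def algebra_simps sum.distrib scaleR_sum_right)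

lemma linear_matrix_mult_left: "linear (\<lambda>A::complex^'n^'n. C ** A)"
  by (rule linearI)
    (simp_all add: vec_eq_iff matrix_matrix_mult_def algebra_simps sum.distrib scaleR_sum_right)

lemmas conj_mat_linear_simps = linear_0[OF linear_conj_mat] linear_add[OF linear_conj_mat]
  linear_neg[OF linear_conj_mat] linear_diff[OF linear_conj_mat] linear_cmul[OF linear_conj_mat]

lemmas adjoint_mat_linear_simps = linear_0[OF linear_adjoint_mat] linear_add[OF linear_adjoint_mat]
  linear_neg[OF linear_adjoint_mat] linear_diff[OF linear_adjoint_mat]
  linear_cmul[OF linear_adjoint_mat]

lemmas matrix_mult_linear_simps =
  linear_neg[OF linear_matrix_mult_left] linear_neg[OF linear_matrix_mult_right]
  linear_cmul[OF linear_matrix_mult_left] linear_cmul[OF linear_matrix_mult_right]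

lemma conj_mat_conj_mat [simp]: "conj_mat (conj_mat A) = A"
  by (simp add: vec_eq_iff)

lemma adjoint_mat_adjoint_mat [simp]: "adjoint_mat (adjoint_mat A) = A"
  by (simp add: vec_eq_iff)

lemma conj_mat_adjoint_mat: "conj_mat (adjoint_mat A) = adjoint_mat (conj_mat A)"
  by (simp add: vec_eq_iff)

lemma conj_mat_mult: "conj_mat (A ** B) = conj_mat A ** conj_mat B"
  by (simp add: vec_eq_iff matrix_matrix_mult_def)

lemma adjoint_mat_mult: "adjoint_mat (A ** B) = adjoint_mat B ** adjoint_mat A"
  by (simp add: vec_eq_iff matrix_matrix_mult_def mult.commute)

lemma conj_mat_one [simp]: "conj_mat (mat 1) = mat 1"
  by (simp add: vec_eq_iff mat_def)

lemma adjoint_mat_one [simp]: "adjoint_mat (mat 1) = mat 1"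
  by (simp add: vec_eq_iff mat_def eq_commute)

lemma imul_mult_left: "imul A ** B = imul (A ** B)"
  and imul_mult_right: "A ** imul B = imul (A ** B)"
  by (simp_all add: vec_eq_iff matrix_matrix_mult_def sum_distrib_left mult_ac)

lemma inner_complex_Re: "x \<bullet> y = Re (cnj x * y)"
  by (simp add: inner_complex_def)

text \<open>Lets cyclicity of the trace move matrix factors across the Euclidean inner product,
  turning them into adjoints.\<close>

lemma inner_mat_eq_trace: "A \<bullet> B = Re (mtrace (adjoint_mat A ** B))"
proof -
  have "A \<bullet> B = (\<Sum>i\<in>UNIV. \<Sum>j\<in>UNIV. Re (cnj (A$i$j) * B$i$j))"
    by (simp add: inner_vec_def inner_complex_Re)
  also have "\<dots> = (\<Sum>j\<in>UNIV. \<Sum>i\<in>UNIV. Re (cnj (A$i$j) * B$i$j))"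
    by (rule sum.swap)
  finally show ?thesis
    by (simp add: mtrace_def matrix_matrix_mult_def)
qed

lemma mtrace_commute: "mtrace (A ** B) = mtrace (B ** A)"
  unfolding mtrace_def matrix_matrix_mult_def
  by (simp, subst sum.swap, simp add: mult.commute)

lemma inner_mult_left:
  fixes A B C :: "complex^'n^'n"
  shows "(C ** A) \<bullet> B = A \<bullet> (adjoint_mat C ** B)"
  by (simp add: inner_mat_eq_trace adjoint_mat_mult matrix_mul_assoc)

lemma inner_mult_right:
  fixes A B C :: "complex^'n^'n"
  shows "(A ** C) \<bullet> B = A \<bullet> (B ** adjoint_mat C)"
  by (simp add: inner_mat_eq_trace adjoint_mat_mult matrix_mul_assoc)
    (metis matrix_mul_assoc mtrace_commute)

lemma inner_conj_mat: "conj_mat A \<bullet> B = A \<bullet> conj_mat B"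
  by (simp add: inner_vec_def inner_complex_def)

lemma inner_adjoint_mat: "adjoint_mat A \<bullet> adjoint_mat B = A \<bullet> B"
  by (simp add: inner_vec_def inner_complex_def) (rule sum.swap)

section \<open>Hermitian matrices and their real and imaginary parts\<close>

definition herm_space :: "(complex^'n^'n) set" where
  "herm_space = {A. adjoint_mat A = A}"

lemma subspace_herm_space: "subspace herm_space"
  by (auto simp: subspace_def herm_space_def adjoint_mat_linear_simps)

lemma dim_herm_space: "dim (herm_space :: (complex^'n::finite^'n) set) = CARD('n)^2"
proof -
  have "2 * dim {A :: complex^'n^'n. adjoint_mat A = A} = DIM(complex^'n^'n)"
    by (rule dim_real_structure[where j = imul])
      (simp_all add: linear_adjoint_mat linear_imul, simp_all add: vec_eq_iff)
  then show ?thesis by (simp add: herm_space_def power2_eq_square)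
qed

text \<open>Presents so(N) as an eigenspace of entrywise conjugation, the case
  \<open>U = mat 1\<close> of the odd spaces \<open>cp_odd U\<close> below.\<close>

lemma so_herm_eq: "so_herm = {A \<in> herm_space. conj_mat A = - A}"
proof (intro equalityI subsetI)
  fix A :: "complex^'n^'n" assume "A \<in> so_herm"
  then obtain R :: "real^'n^'n" where R: "transpose R = - R"
    and A: "A = (\<chi> i j. \<i> * complex_of_real (R$i$j))" unfolding so_herm_def by blast
  have R': "R$j$i = - R$i$j" for i j
    using arg_cong[OF R, of "\<lambda>X. X$i$j"] by (simp add: transpose_def)
  have "cnj (A$j$i) = A$i$j" for i j
    unfolding A using R'[of j i] by (simp add: complex_eq_iff)
  moreover have "cnj (A$i$j) = - A$i$j" for i j
    by (simp add: A complex_eq_iff)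
  ultimately have "adjoint_mat A = A" "conj_mat A = - A"
    by (simp_all add: vec_eq_iff)
  then show "A \<in> {A \<in> herm_space. conj_mat A = - A}" by (simp add: herm_space_def)
next
  fix A :: "complex^'n^'n" assume A: "A \<in> {A \<in> herm_space. conj_mat A = - A}"
  define R :: "real^'n^'n" where "R = (\<chi> i j. Im (A$i$j))"
  from A have c: "cnj (A$i$j) = - A$i$j" and h: "cnj (A$j$i) = A$i$j" for i j
    unfolding herm_space_def mem_Collect_eq
    by (metis conj_mat_nth vector_uminus_component, metis adjoint_mat_nth)
  have "Re (A$i$j) = 0" for i j using arg_cong[OF c[of i j], of Re] by simp
  then have "A = (\<chi> i j. \<i> * complex_of_real (R$i$j))"
    by (simp add: vec_eq_iff R_def complex_eq_iff)
  moreover have "(transpose R)$i$j = (- R)$i$j" for i j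
    using arg_cong[OF h[of i j], of Im] by (simp add: R_def transpose_def)
  then have "transpose R = - R" unfolding vec_eq_iff by blast
  ultimately show "A \<in> so_herm" unfolding so_herm_def by blast
qed

lemma subspace_so_herm: "subspace so_herm"
  by (auto simp: so_herm_eq subspace_def conj_mat_linear_simps herm_space_def adjoint_mat_linear_simps)

definition sym_real :: "(complex^'n^'n) set" where
  "sym_real = {A \<in> herm_space. conj_mat A = A}"

lemma subspace_sym_real: "subspace sym_real"
  by (auto simp: sym_real_def subspace_def conj_mat_linear_simps herm_space_def adjoint_mat_linear_simps)

text \<open>The two spaces belong to opposite eigenvalues of conjugation, so their sum inside
  \<open>herm_space\<close> is direct.\<close>

lemma dim_so_herm_plus_dim_sym_real:
  "dim (so_herm :: (complex^'n::finite^'n) set) + dim (sym_real :: (complex^'n^'n) set) \<le> CARD('n)^2"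
proof -
  let ?S = "so_herm :: (complex^'n^'n) set" and ?T = "sym_real :: (complex^'n^'n) set"
  have "?S \<inter> ?T \<subseteq> {0}"
  proof
    fix A assume "A \<in> ?S \<inter> ?T"
    then have "A = - A" by (auto simp: so_herm_eq sym_real_def)
    then show "A \<in> {0}" by (simp add: eq_neg_iff_add_eq_0 flip: scaleR_2)
  qed
  then have "dim (?S \<inter> ?T) = 0" by simp
  moreover have "{x + y |x y. x \<in> ?S \<and> y \<in> ?T} \<subseteq> herm_space"
    using subspace_add[OF subspace_herm_space] by (auto simp: so_herm_eq sym_real_def)
  then have "dim {x + y |x y. x \<in> ?S \<and> y \<in> ?T} \<le> CARD('n)^2"
    using dim_subset[of "{x + y |x y. x \<in> ?S \<and> y \<in> ?T}" herm_space]
    by (simp add: dim_herm_space)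
  ultimately show ?thesis
    using dim_sums_Int[OF subspace_so_herm subspace_sym_real, where 'a1='n] by linarith
qed

lemma independent_image_orthogonal:
  fixes f :: "'i \<Rightarrow> 'a::euclidean_space"
  assumes "\<And>i j. i \<in> I \<Longrightarrow> j \<in> I \<Longrightarrow> i \<noteq> j \<Longrightarrow> f i \<bullet> f j = 0" and "\<And>i. i \<in> I \<Longrightarrow> f i \<noteq> 0"
  shows "independent (f ` I)" "inj_on f I"
proof -
  show "inj_on f I" using assms by (metis inj_onI inner_eq_zero_iff)
  show "independent (f ` I)"
    using assms by (intro pairwise_orthogonal_independent) (auto simp: pairwise_def orthogonal_def)
qed

lemma nK_le: "nK TYPE('n::finite) \<le> nG TYPE('n)"
proof -
  have "CARD('n) \<ge> 1" by (simp add: Suc_leI)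
  then obtain m where m: "CARD('n) = Suc m" by (metis Suc_le_D One_nat_def)
  have "Suc m * m div 2 \<le> m * (m + 2)"
    by (intro div_le_mono2[of 1 2, THEN order_trans]) auto
  then show ?thesis by (simp add: nK_def nG_def m power2_eq_square)
qed

section \<open>Gell-Mann matrices as an orthogonal basis, and the dimension of so(N)\<close>

locale gell_mann_basis =
  fixes lam :: "nat \<Rightarrow> complex^'n::finite^'n"
  assumes gell_mann: "gell_mann lam"
begin

lemma lam_herm: "a < nG TYPE('n) \<Longrightarrow> lam a \<in> herm_space"
  using gell_mann by (simp add: gell_mann_def herm_space_def hermitian_mat_iff_adjoint)

lemma lam_inner: "a < nG TYPE('n) \<Longrightarrow> b < nG TYPE('n) \<Longrightarrow> lam a \<bullet> lam b = (if a = b then 2 else 0)"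
  using gell_mann lam_herm[of a] by (simp add: gell_mann_def inner_mat_eq_trace herm_space_def)

lemma lam_inner_one: "a < nG TYPE('n) \<Longrightarrow> mat 1 \<bullet> lam a = 0"
  using gell_mann by (simp add: gell_mann_def inner_mat_eq_trace)

lemma lam_nonzero: "a < nG TYPE('n) \<Longrightarrow> lam a \<noteq> 0"
  using lam_inner[of a a] by auto

lemma independent_lam:
  assumes "I \<subseteq> {..<nG TYPE('n)}"
  shows "independent (lam ` I)" "inj_on lam I"
proof -
  have "lam i \<bullet> lam j = 0" if "i \<in> I" "j \<in> I" "i \<noteq> j" for i j
    using that assms by (subst lam_inner) auto
  moreover have "lam i \<noteq> 0" if "i \<in> I" for i using lam_nonzero that assms by auto
  ultimately show "independent (lam ` I)" "inj_on lam I"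
    using independent_image_orthogonal[of I lam] by blast+
qed

lemma independent_lam_one:
  assumes "I \<subseteq> {..<nG TYPE('n)}"
  shows "independent (insert (mat 1) (lam ` I))" "card (insert (mat 1) (lam ` I)) = Suc (card I)"
proof -
  have fin: "finite I" using assms finite_subset by blast
  \<comment> \<open>Indexing by \<open>option\<close>, with \<open>None\<close> for the identity,
    makes this one orthogonal family, so independence and cardinality come together.\<close>
  define f where "f = case_option (mat 1) lam"
  have im: "f ` insert None (Some ` I) = insert (mat 1) (lam ` I)"
    by (auto simp: f_def image_iff)
  have 1: "(mat 1 :: complex^'n^'n) \<noteq> 0"
    by (simp add: mat_def vec_eq_iff)
  have "f i \<bullet> f j = 0" if "i \<in> insert None (Some ` I)" "j \<in> insert None (Some ` I)" "i \<noteq> j" for i j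
    using that assms lam_inner_one lam_inner
    by (auto simp: f_def inner_commute split: option.splits) (metis inner_commute lessThan_iff subsetD)+
  moreover have "f i \<noteq> 0" if "i \<in> insert None (Some ` I)" for i
    using that assms lam_nonzero 1 by (auto simp: f_def)
  ultimately have ind: "independent (f ` insert None (Some ` I))" "inj_on f (insert None (Some ` I))"
    using independent_image_orthogonal[of "insert None (Some ` I)" f] by blast+
  show "independent (insert (mat 1) (lam ` I))" using ind(1) unfolding im .
  show "card (insert (mat 1) (lam ` I)) = Suc (card I)"
    using card_image[OF ind(2)] fin unfolding im by (simp add: card_image)
qed

text \<open>A squeeze: the first k generators lie in \<open>so_herm\<close>, the others together
  with the identity lie in \<open>sym_real\<close>, and these lower bounds already add up to the
  upper bound N^2 for the sum of the dimensions.\<close>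

lemma dim_so_herm: "dim (so_herm :: (complex^'n^'n) set) = nK TYPE('n)"
proof -
  let ?k = "nK TYPE('n)" and ?g = "nG TYPE('n)"
  have "lam ` {..<?k} \<subseteq> so_herm"
  proof safe
    fix a assume "a < ?k"
    then have "a < ?g" "\<forall>i j. Re (lam a $ i $ j) = 0"
      using nK_le[where 'n='n] gell_mann by (auto simp: gell_mann_def)
    then show "lam a \<in> so_herm"
      using lam_herm by (auto simp: so_herm_eq vec_eq_iff complex_eq_iff)
  qed
  moreover have "independent (lam ` {..<?k})" "card (lam ` {..<?k}) = ?k"
    using independent_lam[of "{..<?k}"] nK_le[where 'n='n] by (auto simp: card_image)
  ultimately have 1: "?k \<le> dim (so_herm :: (complex^'n^'n) set)"
    using independent_card_le_dim by metis
  have "insert (mat 1) (lam ` {?k..<?g}) \<subseteq> sym_real"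
  proof -
    have "lam a \<in> sym_real" if "?k \<le> a" "a < ?g" for a
    proof -
      have "\<forall>i j. Im (lam a $ i $ j) = 0" using that gell_mann by (auto simp: gell_mann_def)
      then show ?thesis using lam_herm[OF that(2)] by (auto simp: sym_real_def vec_eq_iff complex_eq_iff)
    qed
    then show ?thesis by (auto simp: sym_real_def herm_space_def)
  qed
  moreover have "independent (insert (mat 1) (lam ` {?k..<?g}))"
     "card (insert (mat 1) (lam ` {?k..<?g})) = Suc (?g - ?k)"
    using independent_lam_one[of "{?k..<?g}"] by fastforce+
  ultimately have 2: "Suc (?g - ?k) \<le> dim (sym_real :: (complex^'n^'n) set)"
    using independent_card_le_dim by metis
  have "CARD('n)^2 = Suc ?g" by (simp add: nG_def)
  with 1 2 dim_so_herm_plus_dim_sym_real[where 'n='n] nK_le[where 'n='n] show ?thesis by linarith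
qed

text \<open>The identity and the generators are N^2 independent Hermitian matrices, hence span
  \<open>herm_space\<close>; so \<open>A\<close> is orthogonal to itself.\<close>

lemma herm_eq_0:
  assumes A: "A \<in> herm_space" and "mat 1 \<bullet> A = 0" and "\<And>a. a < nG TYPE('n) \<Longrightarrow> lam a \<bullet> A = 0"
  shows "A = 0"
proof -
  let ?B = "insert (mat 1) (lam ` {..<nG TYPE('n)})"
  have "?B \<subseteq> herm_space" using lam_herm by (auto simp: herm_space_def)
  moreover have "CARD('n)^2 = Suc (nG TYPE('n))" by (simp add: nG_def)
  ultimately have "herm_space \<subseteq> span ?B"
    using independent_lam_one[of "{..<nG TYPE('n)}"] dim_herm_space[where 'n='n]
    by (intro card_ge_dim_independent) auto
  then have "A \<in> span ?B" using A by blast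
  moreover have "orthogonal A b" if "b \<in> ?B" for b
    using that assms by (auto simp: orthogonal_def inner_commute)
  ultimately have "orthogonal A A" using orthogonal_to_span by blast
  then show ?thesis by (simp add: orthogonal_self)
qed

end

subsection \<open>Antiunitary reflections of Hermitian matrices\<close>

definition cp_refl :: "complex^'n^'n \<Rightarrow> complex^'n^'n \<Rightarrow> complex^'n^'n" where
  "cp_refl U A = U ** conj_mat A ** adjoint_mat U"

definition cp2_mat :: "complex^'n::finite^'n \<Rightarrow> bool" where
  "cp2_mat U \<longleftrightarrow> unitary_mat U \<and> U ** conj_mat U = mat 1"

definition cp_odd :: "complex^'n^'n \<Rightarrow> (complex^'n^'n) set" where
  "cp_odd U = {A \<in> herm_space. cp_refl U A = - A}"

lemma linear_cp_refl: "linear (cp_refl U)"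
  using linear_compose[OF linear_compose[OF linear_conj_mat linear_matrix_mult_left[of U]]
      linear_matrix_mult_right[of "adjoint_mat U"]]
  by (simp add: cp_refl_def[abs_def] o_def)

lemmas cp_refl_linear_simps = linear_0[OF linear_cp_refl] linear_add[OF linear_cp_refl]
  linear_neg[OF linear_cp_refl] linear_diff[OF linear_cp_refl] linear_cmul[OF linear_cp_refl]

lemma cp_refl_herm: "A \<in> herm_space \<Longrightarrow> cp_refl U A \<in> herm_space"
  by (simp add: herm_space_def cp_refl_def adjoint_mat_mult matrix_mul_assoc flip: conj_mat_adjoint_mat)

text \<open>Both sides are the inverse of \<open>U\<close>; equivalently, \<open>U\<close> is
  symmetric.\<close>

lemma cp2_mat_conj:
  assumes "cp2_mat U" shows "conj_mat U = adjoint_mat U"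
proof -
  have "conj_mat U = (adjoint_mat U ** U) ** conj_mat U"
    using assms by (simp add: cp2_mat_def unitary_mat_def)
  also have "\<dots> = adjoint_mat U"
    using assms by (simp add: cp2_mat_def flip: matrix_mul_assoc)
  finally show ?thesis .
qed

lemma cp_refl_cp_refl:
  assumes "cp2_mat U" shows "cp_refl U (cp_refl U A) = A"
proof -
  have "cp_refl U (cp_refl U A) = (U ** conj_mat U) ** A ** (adjoint_mat (conj_mat U) ** adjoint_mat U)"
    by (simp add: cp_refl_def conj_mat_mult conj_mat_adjoint_mat matrix_mul_assoc)
  also have "\<dots> = A" using assms by (simp add: cp2_mat_def flip: adjoint_mat_mult)
  finally show ?thesis .
qed

lemma cp_refl_one: "cp2_mat U \<Longrightarrow> cp_refl U (mat 1) = mat 1"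
  by (simp add: cp_refl_def cp2_mat_def unitary_mat_def)

lemma cp_refl_inner:
  assumes "cp2_mat U" shows "cp_refl U A \<bullet> B = A \<bullet> cp_refl U B"
proof -
  have c: "conj_mat (adjoint_mat U) = U"
    using cp2_mat_conj[OF assms] by (metis conj_mat_conj_mat)
  have "cp_refl U A \<bullet> B = A \<bullet> conj_mat (adjoint_mat U ** (B ** U))"
    unfolding cp_refl_def inner_mult_right[of "U ** conj_mat A"] inner_mult_left[of U "conj_mat A"]
      inner_conj_mat by simp
  then show ?thesis
    by (simp add: cp_refl_def conj_mat_mult c cp2_mat_conj[OF assms] matrix_mul_assoc)
qed

lemma subspace_cp_odd: "subspace (cp_odd U)"
  using subspace_herm_space unfolding subspace_def cp_odd_def
  by (auto simp: cp_refl_linear_simps)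

lemma unitary_matI:
  fixes T :: "complex^'n::finite^'n"
  shows "adjoint_mat T ** T = mat 1 \<Longrightarrow> unitary_mat T"
    and "T ** adjoint_mat T = mat 1 \<Longrightarrow> unitary_mat T"
  using matrix_left_right_inverse unfolding unitary_mat_def by blast+

text \<open>The fixed vectors of the antiunitary involution \<open>x \<mapsto> U x\<^sup>*\<close> form a real form of \<open>\<complex>\<^sup>N\<close> on
  which the Hermitian inner product is real; the columns of T are an orthonormal basis of it.\<close>
lemma takagi_unitary:
  fixes U :: "complex^'n::finite^'n"
  assumes U: "cp2_mat U"
  obtains T where "unitary_mat T" "U ** conj_mat T = T"
proof -
  define s where "s x = U *v (\<chi> i. cnj (x$i))" for x
  define j where "j x = (\<chi> i. \<i> * x$i)" for x :: "complex^'n"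
  let ?F = "{x. s x = x}"
  have s: "linear s"
    by (rule linearI) (simp_all add: s_def vec_eq_iff matrix_vector_mult_def algebra_simps
        sum.distrib scaleR_sum_right)
  have "s (s x) = x" for x
  proof -
    have "(\<chi> i. cnj (s x $ i)) = conj_mat U *v x"
      by (simp add: s_def vec_eq_iff matrix_vector_mult_def)
    then have "s (s x) = (U ** conj_mat U) *v x"
      by (simp add: s_def[of "s x"] matrix_vector_mul_assoc)
    then show ?thesis using U by (simp add: cp2_mat_def)
  qed
  moreover have "linear j" by (rule linearI) (simp_all add: j_def vec_eq_iff algebra_simps)
  moreover have "j (j x) = - x" for x by (simp add: j_def vec_eq_iff)
  moreover have "s (j x) = - j (s x)" for x
    by (simp add: j_def s_def vec_eq_iff matrix_vector_mult_def sum_distrib_left sum_negf mult_ac)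
  \<comment> \<open>The real dimension of \<open>complex^'n\<close> is 2N, so the fixed space has
    real dimension N and its basis can be indexed by \<open>'n\<close>, as the columns of a square
    matrix.\<close>
  ultimately have dim: "dim ?F = CARD('n)"
    using dim_real_structure[OF s, of j] by simp
  have "subspace ?F"
    using s by (auto simp: subspace_def linear_0 linear_add linear_cmul)
  then obtain B where B: "B \<subseteq> ?F" "pairwise orthogonal B"
    "\<And>x. x \<in> B \<Longrightarrow> norm x = 1" "independent B" "card B = dim ?F"
    by (rule orthonormal_basis_subspace) blast
  have "finite B" using B(4) by (rule independent_imp_finite)
  then obtain g where g: "bij_betw g (UNIV::'n set) B"
    using finite_same_card_bij[of "UNIV::'n set" B] B(5) dim by auto
  have gB: "g k \<in> B" for k using g by (auto simp: bij_betw_def)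
  have inner: "g k \<bullet> g l = (if k = l then 1 else 0)" for k l
  proof (cases "k = l")
    case True then show ?thesis using B(3)[OF gB[of k]] by (simp add: norm_eq_1)
  next
    case False
    then have "g k \<noteq> g l" using g by (auto simp: bij_betw_def inj_def)
    then show ?thesis using False B(2) gB by (auto simp: pairwise_def orthogonal_def)
  qed
  define T :: "complex^'n^'n" where "T = (\<chi> i k. g k $ i)"
  have UT: "U ** conj_mat T = T"
  proof -
    have "s (g k) $ i = g k $ i" for i k using subsetD[OF B(1) gB[of k]] by simp
    then show ?thesis by (simp add: T_def s_def vec_eq_iff matrix_vector_mult_def matrix_matrix_mult_def)
  qed
  let ?M = "adjoint_mat T ** T"
  \<comment> \<open>Unitarity of \<open>U\<close> gives \<open>T\<^sup>*\<close> and
    \<open>U T\<^sup>* = T\<close> the same Gram matrix. Hence \<open>?M\<close> is real, and its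
    entries are the Euclidean inner products of the orthonormal columns.\<close>
  have "conj_mat ?M = adjoint_mat (conj_mat T) ** (adjoint_mat U ** U) ** conj_mat T"
    using U by (simp add: cp2_mat_def unitary_mat_def conj_mat_mult conj_mat_adjoint_mat)
  also have "\<dots> = adjoint_mat (U ** conj_mat T) ** (U ** conj_mat T)"
    by (simp add: adjoint_mat_mult matrix_mul_assoc)
  finally have "conj_mat ?M = ?M" by (simp add: UT)
  then have "Im (?M $ k $ l) = 0" for k l
    by (metis complex_cnj_cancel_iff conj_mat_nth Reals_cnj_iff complex_is_Real_iff)
  moreover have "Re (?M $ k $ l) = g k \<bullet> g l" for k l
    by (simp add: matrix_matrix_mult_def T_def inner_vec_def inner_complex_Re)
  ultimately have "?M = mat 1"
    by (simp add: vec_eq_iff mat_def complex_eq_iff inner)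
  then show thesis using that UT unitary_matI by blast
qed

text \<open>With \<open>U T\<^sup>* = T\<close>, conjugation by \<open>T\<close> turns the
  reflection \<open>cp_refl U\<close> into entrywise conjugation (fact \<open>conj\<close>), whose
  odd Hermitian matrices form \<open>so_herm\<close>.\<close>

lemma cp_odd_eq_conjugate_so_herm:
  fixes U :: "complex^'n::finite^'n"
  assumes U: "cp2_mat U"
  obtains T where "unitary_mat T" "(\<lambda>A. adjoint_mat T ** A ** T) ` cp_odd U = so_herm"
proof -
  obtain T where T: "unitary_mat T" "U ** conj_mat T = T" using takagi_unitary[OF U] .
  have TT: "adjoint_mat T ** T = mat 1" "T ** adjoint_mat T = mat 1"
    using T by (simp_all add: unitary_mat_def)
  have T': "adjoint_mat T ** U = adjoint_mat (conj_mat T)"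
  proof -
    have "adjoint_mat T ** U = adjoint_mat (conj_mat T) ** (adjoint_mat U ** U)"
      by (metis T(2) adjoint_mat_mult matrix_mul_assoc)
    then show ?thesis using U by (simp add: cp2_mat_def unitary_mat_def)
  qed
  have U': "adjoint_mat U ** T = conj_mat T"
    by (metis T' adjoint_mat_adjoint_mat adjoint_mat_mult)
  have herm: "adjoint_mat T ** A ** T \<in> herm_space \<longleftrightarrow> A \<in> herm_space" for A
  proof -
    have "adjoint_mat A = A" if "adjoint_mat T ** adjoint_mat A ** T = adjoint_mat T ** A ** T"
    proof -
      have "T ** (adjoint_mat T ** adjoint_mat A ** T) ** adjoint_mat T
          = T ** (adjoint_mat T ** A ** T) ** adjoint_mat T" using that by simp
      then have "(T ** adjoint_mat T) ** adjoint_mat A ** (T ** adjoint_mat T)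
          = (T ** adjoint_mat T) ** A ** (T ** adjoint_mat T)" by (simp add: matrix_mul_assoc)
      then show ?thesis by (simp add: TT)
    qed
    then show ?thesis by (auto simp: herm_space_def adjoint_mat_mult matrix_mul_assoc)
  qed
  have conj: "conj_mat (adjoint_mat T ** A ** T) = adjoint_mat T ** cp_refl U A ** T" for A
  proof -
    have "adjoint_mat T ** cp_refl U A ** T
        = (adjoint_mat T ** U) ** conj_mat A ** (adjoint_mat U ** T)"
      by (simp add: cp_refl_def matrix_mul_assoc)
    then show ?thesis by (simp add: T' U' conj_mat_mult conj_mat_adjoint_mat)
  qed
  have "(\<lambda>A. adjoint_mat T ** A ** T) ` cp_odd U = so_herm"
  proof (intro equalityI subsetI)
    fix B assume "B \<in> (\<lambda>A. adjoint_mat T ** A ** T) ` cp_odd U"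
    then show "B \<in> so_herm"
      by (auto simp: cp_odd_def so_herm_eq herm conj matrix_mult_linear_simps)
  next
    fix B :: "complex^'n^'n" assume B: "B \<in> so_herm"
    define A where "A = T ** B ** adjoint_mat T"
    have BA: "B = adjoint_mat T ** A ** T"
    proof -
      have "adjoint_mat T ** A ** T = (adjoint_mat T ** T) ** B ** (adjoint_mat T ** T)"
        by (simp add: A_def matrix_mul_assoc)
      then show ?thesis by (simp add: TT)
    qed
    have "cp_refl U A = T ** (adjoint_mat T ** cp_refl U A ** T) ** adjoint_mat T"
    proof -
      have "T ** (adjoint_mat T ** cp_refl U A ** T) ** adjoint_mat T
        = (T ** adjoint_mat T) ** cp_refl U A ** (T ** adjoint_mat T)" by (simp add: matrix_mul_assoc)
      then show ?thesis by (simp add: TT)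
    qed
    also have "\<dots> = T ** conj_mat B ** adjoint_mat T" by (simp add: conj BA)
    also have "\<dots> = - A" using B by (simp add: so_herm_eq A_def matrix_mult_linear_simps)
    finally have "A \<in> cp_odd U" using B herm[of A] BA by (simp add: cp_odd_def so_herm_eq)
    then show "B \<in> (\<lambda>A. adjoint_mat T ** A ** T) ` cp_odd U" using BA by blast
  qed
  then show thesis using that T by blast
qed

lemma inj_conjugate:
  fixes S S' :: "complex^'n::finite^'n"
  assumes "S' ** S = mat 1" shows "inj (\<lambda>A. S ** A ** S')"
proof (rule injI)
  fix A B assume e: "S ** A ** S' = S ** B ** S'"
  have "S' ** (S ** C ** S') ** S = C" for C
  proof -
    have "S' ** (S ** C ** S') ** S = (S' ** S) ** C ** (S' ** S)" by (simp add: matrix_mul_assoc)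
    then show ?thesis by (simp add: assms)
  qed
  then show "A = B" by (metis e)
qed

lemma linear_conjugate:
  fixes S S' :: "complex^'n^'n"
  shows "linear (\<lambda>A. S ** A ** S')"
  using linear_compose[OF linear_matrix_mult_left[of S] linear_matrix_mult_right[of S']]
  by (simp add: o_def)

lemma dim_conjugate:
  fixes S S' :: "complex^'n::finite^'n"
  assumes "S' ** S = mat 1" shows "dim ((\<lambda>A. S ** A ** S') ` W) = dim W"
  by (rule dim_image_eq[OF linear_conjugate]) (use inj_conjugate[OF assms] inj_on_subset in blast)

lemma dim_cp_odd:
  fixes U :: "complex^'n::finite^'n"
  assumes "cp2_mat U"
  shows "dim (cp_odd U) = dim (so_herm :: (complex^'n^'n) set)"
proof -
  obtain T where T: "unitary_mat T" "(\<lambda>A. adjoint_mat T ** A ** T) ` cp_odd U = so_herm"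
    using cp_odd_eq_conjugate_so_herm[OF assms] .
  then show ?thesis
    using dim_conjugate[of T "adjoint_mat T" "cp_odd U"] by (simp add: unitary_mat_def)
qed

text \<open>The reflection is multiplicative and antilinear: the two signs of the odd factors cancel
  in each product, and the factor -i supplies the remaining sign.\<close>

lemma cp_odd_commutator:
  assumes U: "cp2_mat U" and A: "A \<in> cp_odd U" and B: "B \<in> cp_odd U"
  shows "mcomm_i A B \<in> cp_odd U"
proof -
  have eq: "mcomm_i X Y = - imul (X ** Y) + imul (Y ** X)" for X Y :: "complex^'n^'n"
    by (simp add: mcomm_i_def vec_eq_iff algebra_simps)
  have mult: "cp_refl U (X ** Y) = cp_refl U X ** cp_refl U Y" for X Y
  proof -
    have "cp_refl U X ** cp_refl U Y = U ** conj_mat X ** (adjoint_mat U ** U) ** conj_mat Y ** adjoint_mat U"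
      by (simp add: cp_refl_def matrix_mul_assoc)
    also have "adjoint_mat U ** U = mat 1" using U by (simp add: cp2_mat_def unitary_mat_def)
    finally show ?thesis by (simp add: cp_refl_def conj_mat_mult matrix_mul_assoc)
  qed
  have ci: "conj_mat (imul X) = - imul (conj_mat X)" and ai: "adjoint_mat (imul X) = - imul (adjoint_mat X)"
    for X :: "complex^'n^'n"
    by (simp_all add: vec_eq_iff)
  have im: "cp_refl U (imul X) = - imul (cp_refl U X)" for X
    by (simp add: cp_refl_def ci matrix_mult_linear_simps imul_mult_left imul_mult_right)
  have "adjoint_mat (mcomm_i A B) = mcomm_i A B"
    using A B by (simp add: eq adjoint_mat_linear_simps ai adjoint_mat_mult cp_odd_def herm_space_def)
  moreover have "cp_refl U (mcomm_i A B) = - mcomm_i A B"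
    using A B by (simp add: eq cp_refl_linear_simps im mult cp_odd_def matrix_mult_linear_simps)
  ultimately show ?thesis by (simp add: cp_odd_def herm_space_def)
qed

text \<open>Even and odd Hermitian matrices are orthogonal complements. This is what translates
  invariance of L and M into orthogonality to the eigenvectors.\<close>

lemma cp_refl_fixed_iff:
  assumes U: "cp2_mat U" and A: "A \<in> herm_space"
  shows "cp_refl U A = A \<longleftrightarrow> (\<forall>B\<in>cp_odd U. A \<bullet> B = 0)"
proof
  assume *: "cp_refl U A = A"
  show "\<forall>B\<in>cp_odd U. A \<bullet> B = 0"
  proof
    fix B assume "B \<in> cp_odd U"
    then have "A \<bullet> B = - (A \<bullet> B)"
      using cp_refl_inner[OF U, of A B] * by (simp add: cp_odd_def)
    then show "A \<bullet> B = 0" by simp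
  qed
next
  assume *: "\<forall>B\<in>cp_odd U. A \<bullet> B = 0"
  let ?D = "A - cp_refl U A"
  have "?D \<in> cp_odd U"
    using subspace_diff[OF subspace_herm_space A cp_refl_herm[OF A, of U]]
    by (simp add: cp_odd_def cp_refl_linear_simps cp_refl_cp_refl[OF U])
  then have "A \<bullet> ?D = 0" "cp_refl U ?D = - ?D"
    using * by (blast, simp add: cp_odd_def)
  then have "A \<bullet> ?D = 0" "cp_refl U A \<bullet> ?D = 0"
    using cp_refl_inner[OF U, of A ?D] by (simp_all only: inner_minus_right neg_equal_0_iff_equal)
  then have "?D \<bullet> ?D = 0" by (simp only: inner_diff_left)
  then show "cp_refl U A = A" by simp
qed

subsection \<open>Conjugates of so(N) consisting of Hermitian matrices\<close>

text \<open>Compare column q of \<open>H ** E p q\<close> and \<open>E p q ** H\<close>: row p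
  equates two diagonal entries, and a row i outside {p, q} forces \<open>H $ i $ p = 0\<close>. For
  an off-diagonal entry this takes an index q different from i and p, whence N at least 3.\<close>

lemma commutant_so_herm:
  fixes H :: "complex^'n::finite^'n"
  assumes N: "CARD('n) \<ge> 3" and comm: "\<And>B. B \<in> so_herm \<Longrightarrow> H ** B = B ** H"
  obtains c where "H = mat c"
proof -
  define E :: "'n \<Rightarrow> 'n \<Rightarrow> complex^'n^'n"
    where "E p q = (\<chi> i j. if i = p \<and> j = q then \<i> else if i = q \<and> j = p then - \<i> else 0)" for p q
  have E: "E p q \<in> so_herm" if "p \<noteq> q" for p q
    using that by (auto simp: E_def so_herm_eq herm_space_def vec_eq_iff)
  have HE: "(H ** E p q) $ i $ q = H $ i $ p * \<i>" if "p \<noteq> q" for p q i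
  proof -
    have "H $ i $ l * E p q $ l $ q = (if l = p then H $ i $ p * \<i> else 0)" for l
      using that by (simp add: E_def)
    then show ?thesis by (simp add: matrix_matrix_mult_def)
  qed
  have EH: "(E p q ** H) $ i $ q = (if i = p then \<i> * H $ q $ q else if i = q then - \<i> * H $ p $ q else 0)"
    if "p \<noteq> q" for p q i
  proof -
    have "E p q $ i $ l * H $ l $ q = (if l = (if i = p then q else p) then
       if i = p then \<i> * H $ q $ q else if i = q then - \<i> * H $ p $ q else 0 else 0)" for l
      using that by (simp add: E_def)
    then show ?thesis by (simp add: matrix_matrix_mult_def)
  qed
  have eq: "H $ i $ p * \<i> = (if i = p then \<i> * H $ q $ q else if i = q then - \<i> * H $ p $ q else 0)"
    if "p \<noteq> q" for p q i
    using HE[OF that, of i] EH[OF that, of i] comm[OF E[OF that]] by simp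
  have diag: "H $ p $ p = H $ q $ q" for p q
    using eq[of p q p] by (cases "p = q") (auto simp: mult.commute)
  have off: "H $ i $ p = 0" if "i \<noteq> p" for i p
  proof -
    have "card {i, p} < CARD('n)" using N that by simp
    then obtain q where "q \<notin> {i, p}" by (metis UNIV_I card_mono finite not_less subsetI)
    then show ?thesis using eq[of p q i] that by auto
  qed
  obtain p :: 'n where True by simp
  have "H = mat (H $ p $ p)"
    unfolding vec_eq_iff mat_def using off diag[of _ p] by auto
  then show thesis by (rule that)
qed

lemma cp2_of_conjugate_so_herm_ge3:
  fixes S S' :: "complex^'n::finite^'n"
  assumes N: "CARD('n) \<ge> 3" and W: "W \<subseteq> herm_space"
    and S: "S ** S' = mat 1" "S' ** S = mat 1" and so: "(\<lambda>A. S ** A ** S') ` W = so_herm"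
  obtains U where "cp2_mat U" "W \<subseteq> cp_odd U"
proof -
  \<comment> \<open>For \<open>A\<close> in \<open>W\<close> both \<open>A\<close> and
    \<open>S A S\<^sup>-\<^sup>1\<close> are Hermitian; taking the adjoint of
    \<open>B S = S A\<close> shows that \<open>?H\<close> commutes with \<open>B\<close>. Being
    scalar, \<open>?H\<close> makes \<open>S\<close> a multiple of a unitary matrix.\<close>
  let ?H = "S ** adjoint_mat S"
  have "?H ** B = B ** ?H" if B: "B \<in> so_herm" for B
  proof -
    obtain A where A: "A \<in> W" "B = S ** A ** S'" using B so by blast
    have BS: "B ** S = S ** A" by (metis A(2) S(2) matrix_mul_assoc matrix_mul_rid)
    have "adjoint_mat B = B" "adjoint_mat A = A" using B A W by (auto simp: so_herm_eq herm_space_def)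
    then have "adjoint_mat S ** B = A ** adjoint_mat S" using BS by (metis adjoint_mat_mult)
    then show ?thesis using BS by (metis matrix_mul_assoc)
  qed
  from commutant_so_herm[OF N this] obtain c where c: "?H = mat c" by blast
  have SS: "adjoint_mat S = S' ** mat c"
    using c S(2) by (metis matrix_mul_assoc matrix_mul_lid)
  have cc: "cnj c = c"
  proof -
    have "adjoint_mat ?H = ?H" by (simp add: adjoint_mat_mult)
    then have "adjoint_mat (mat c :: complex^'n^'n) $ i $ i = (mat c :: complex^'n^'n) $ i $ i" for i
      by (simp add: c)
    then show ?thesis by (simp add: mat_def)
  qed
  \<comment> \<open>Entrywise conjugation pulled back along \<open>S\<close>. The identity
    \<open>U U\<^sup>* = 1\<close> is automatic for this form, while unitarity uses that
    \<open>?H\<close> is a real scalar.\<close>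
  define U where "U = S' ** conj_mat S"
  have UU: "U ** conj_mat U = mat 1"
  proof -
    have "U ** conj_mat U = S' ** conj_mat (S ** S') ** S"
      by (simp add: U_def conj_mat_mult matrix_mul_assoc)
    then show ?thesis by (simp add: S)
  qed
  have "U ** adjoint_mat U = S' ** conj_mat ?H ** adjoint_mat S'"
    by (simp add: U_def conj_mat_mult conj_mat_adjoint_mat adjoint_mat_mult matrix_mul_assoc)
  also have "conj_mat ?H = mat c"
    unfolding c using cc by (auto simp: vec_eq_iff mat_def)
  also have "S' ** mat c ** adjoint_mat S' = mat 1"
    unfolding SS[symmetric] by (simp add: S flip: adjoint_mat_mult)
  finally have uni: "U ** adjoint_mat U = mat 1" .
  then have cp2: "cp2_mat U" using UU unitary_matI by (auto simp: cp2_mat_def)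
  have "W \<subseteq> cp_odd U"
  proof
    fix A assume A: "A \<in> W"
    have "conj_mat (S ** A ** S') = - (S ** A ** S')" using A so by (auto simp: so_herm_eq)
    then have "conj_mat (S ** A ** S') ** conj_mat S = - (S ** A ** S') ** conj_mat S" by simp
    moreover have "conj_mat (S ** A ** S') ** conj_mat S = conj_mat (S ** A ** (S' ** S))"
      by (simp add: conj_mat_mult matrix_mul_assoc)
    ultimately have SA: "conj_mat S ** conj_mat A = - (S ** A ** S' ** conj_mat S)"
      by (simp add: S conj_mat_mult matrix_mult_linear_simps)
    have "cp_refl U A = S' ** (conj_mat S ** conj_mat A) ** adjoint_mat U"
      by (simp add: cp_refl_def U_def matrix_mul_assoc)
    also have "\<dots> = - ((S' ** S) ** A ** (U ** adjoint_mat U))"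
      unfolding SA by (simp add: U_def matrix_mult_linear_simps matrix_mul_assoc)
    finally show "A \<in> cp_odd U" using A W by (auto simp: cp_odd_def S uni)
  qed
  then show thesis using that cp2 by blast
qed

text \<open>For N = 2 the commutant of so(2) is not scalar. A traceless Hermitian A satisfies
  \<open>\<epsilon> A\<^sup>* = - A \<epsilon>\<close> and \<open>A\<^sup>2 = c\<close> with \<open>c > 0\<close>, so one can take \<open>U = A \<epsilon> / \<surd>c\<close>.\<close>
lemma cp2_of_traceless_2:
  fixes A :: "complex^'n::finite^'n"
  assumes N: "CARD('n) = 2" and A: "A \<in> herm_space" "mat 1 \<bullet> A = 0" "A \<noteq> 0"
  obtains U where "cp2_mat U" "A \<in> cp_odd U"
proof -
  obtain p q :: 'n where pq: "UNIV = {p, q}" "p \<noteq> q" using N by (auto simp: card_2_iff)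
  have all: "(\<forall>i. P i) \<longleftrightarrow> P p \<and> P q" for P :: "'n \<Rightarrow> bool"
    by (metis UNIV_I insertE pq(1) singletonD)
  have sm: "(\<Sum>i\<in>UNIV. f i) = f p + f q" for f :: "'n \<Rightarrow> complex"
    unfolding pq(1) using pq(2) by simp
  have smr: "(\<Sum>i\<in>UNIV. f i) = f p + f q" for f :: "'n \<Rightarrow> real"
    unfolding pq(1) using pq(2) by simp
  define z where "z = A $ p $ q"
  define r where "r = Re (A $ p $ p)"
  have h: "cnj (A $ j $ i) = A $ i $ j" for i j
    using A(1) unfolding herm_space_def mem_Collect_eq by (metis adjoint_mat_nth)
  have qp: "A $ q $ p = cnj z" using h[of p q] by (simp add: z_def)
  have im: "Im (A $ i $ i) = 0" for i using arg_cong[OF h[of i i], of Im] by simp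
  have tr: "Re (A $ p $ p) + Re (A $ q $ q) = 0"
    using A(2) pq(2) by (simp add: inner_vec_def smr mat_def inner_complex_def)
  have pp: "A $ p $ p = of_real r" "A $ q $ q = - of_real r"
    using im tr by (simp_all add: complex_eq_iff r_def)
  \<comment> \<open>This is minus the determinant of \<open>A\<close>, so
    \<open>A\<^sup>2 = c\<close>.\<close>
  define c where "c = r^2 + (cmod z)^2"
  have "c > 0"
  proof -
    have "r \<noteq> 0 \<or> z \<noteq> 0"
      using A(3) pp qp z_def by (auto simp: vec_eq_iff all)
    then show ?thesis by (auto simp: c_def add_pos_nonneg add_nonneg_pos)
  qed
  define d where "d = complex_of_real (sqrt c)"
  have "d * d = of_real c" using \<open>c > 0\<close> by (simp add: d_def flip: of_real_mult)
  also have "\<dots> = of_real r * of_real r + of_real ((cmod z)\<^sup>2)" by (simp add: c_def power2_eq_square)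
  finally have "d * d = of_real r * of_real r + z * cnj z" by (simp only: complex_norm_square)
  moreover have "d \<noteq> 0" "cnj d = d" using \<open>c > 0\<close> by (simp_all add: d_def)
  ultimately have dd: "d * d = of_real r * of_real r + z * cnj z" "d \<noteq> 0" "cnj d = d" by auto
  \<comment> \<open>The columns of \<open>A \<epsilon> / d\<close>, where \<epsilon> has entry 1 at
    (p, q) and -1 at (q, p).\<close>
  define U :: "complex^'n^'n" where
    "U = (\<chi> i j. (if j = p then - A $ i $ q else A $ i $ p) / d)"
  have U: "U$p$p = - z / d" "U$p$q = of_real r / d" "U$q$p = of_real r / d" "U$q$q = cnj z / d"
    using pq(2) by (simp_all add: U_def pp qp z_def[symmetric])
  have "cp2_mat U"
    unfolding cp2_mat_def
    by (intro conjI unitary_matI)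
      (use pq(2) dd in \<open>simp_all add: vec_eq_iff all matrix_matrix_mult_def sm U mat_def field_simps\<close>)
  moreover have d2: "d * (d * x) = (of_real r * of_real r + z * cnj z) * x" for x
    using dd(1) by (simp flip: mult.assoc)
  have "cp_refl U A = - A"
    using pq(2) dd by (simp add: d2 vec_eq_iff all cp_refl_def matrix_matrix_mult_def sm U pp qp z_def[symmetric] field_simps)
  ultimately show thesis using that A(1) by (simp add: cp_odd_def)
qed

lemma conjugate_so_herm_imp_cp_odd:
  fixes S S' :: "complex^'n::finite^'n"
  assumes N: "CARD('n) \<ge> 2" and sub: "subspace W" and W: "W \<subseteq> herm_space"
    and tr: "\<And>A. A \<in> W \<Longrightarrow> mat 1 \<bullet> A = 0"
    and S: "S ** S' = mat 1" "S' ** S = mat 1" and so: "(\<lambda>A. S ** A ** S') ` W = so_herm"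
    and dim_so: "dim (so_herm :: (complex^'n^'n) set) = nK TYPE('n)"
  obtains U where "cp2_mat U" "W = cp_odd U"
proof -
  have dim: "dim W = dim (so_herm :: (complex^'n^'n) set)"
    using dim_conjugate[OF S(2), of W] so by simp
  obtain U where U: "cp2_mat U" "W \<subseteq> cp_odd U"
  proof (cases "CARD('n) = 2")
    case False
    then show thesis using cp2_of_conjugate_so_herm_ge3[OF _ W S so] that N by auto
  next
    case True
    \<comment> \<open>For N = 2 one has k = 1, so \<open>W\<close> is a line and a single traceless
      Hermitian matrix decides which \<open>U\<close> to take.\<close>
    then have d1: "dim W = 1" by (simp add: dim dim_so nK_def)
    then have "W \<noteq> {0}" by auto
    then obtain A where A: "A \<in> W" "A \<noteq> 0" using sub subspace_0 by blast
    then obtain U where U: "cp2_mat U" "A \<in> cp_odd U"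
      using cp2_of_traceless_2[OF True] W tr by blast
    have "W \<subseteq> span {A}"
      using A d1 by (intro card_ge_dim_independent) auto
    also have "\<dots> \<subseteq> cp_odd U"
      using U subspace_cp_odd by (intro span_minimal) auto
    finally show thesis using that U by blast
  qed
  \<comment> \<open>Inclusion becomes equality because both spaces have the dimension of
    so(N).\<close>
  then have "W = cp_odd U"
    using subspace_dim_equal[OF sub subspace_cp_odd] dim_cp_odd[OF U(1)] dim by simp
  then show thesis using that U by blast
qed

subsection \<open>The potential as a function of a Hermitian matrix\<close>

text \<open>The swapped indices make this \<open>\<Phi> \<Phi>\<^sup>\<dagger>\<close> and not its
  transpose, so that pairing it with \<open>lam a\<close> gives exactly
  \<open>Kbil lam a\<close>.\<close>

definition bilin :: "complex^2^'n \<Rightarrow> complex^'n::finite^'n" where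
  "bilin Phi = (\<chi> i j. dinner (Phi$j) (Phi$i))"

definition outer :: "complex^'n \<Rightarrow> complex^'n^'n" where
  "outer x = (\<chi> i j. x$i * cnj (x$j))"

lemma bilin_herm: "bilin Phi \<in> herm_space"
  by (simp add: herm_space_def bilin_def vec_eq_iff dinner_def mult.commute)

lemma bilin_scaleR: "bilin (t *\<^sub>R Phi) = t\<^sup>2 *\<^sub>R bilin Phi"
  by (simp add: bilin_def dinner_def vec_eq_iff scaleR_sum_right power2_eq_square)

lemma bilin_columns: "bilin (\<chi> i \<alpha>. if \<alpha> = 1 then x$i else y$i) = outer x + outer y"
  by (simp add: bilin_def outer_def dinner_def vec_eq_iff sum_2 mult.commute)

lemma K0_eq_inner: "K0 Phi = mat 1 \<bullet> bilin Phi"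
proof -
  have "mat 1 $ i $ j \<bullet> bilin Phi $ i $ j = (if j = i then Re (dinner (Phi$i) (Phi$i)) else 0)" for i j
    by (simp add: mat_def bilin_def inner_complex_def)
  then show ?thesis by (simp add: K0_def inner_vec_def)
qed

lemma Kbil_eq_inner: "Kbil lam a Phi = lam a \<bullet> bilin Phi"
proof -
  have dinner_swap: "dinner (Phi$j) (Phi$i) = cnj (dinner (Phi$i) (Phi$j))" for i j
    by (simp add: dinner_def mult.commute)
  have "lam a $ i $ j \<bullet> bilin Phi $ i $ j = Re (dinner (Phi$i) (Phi$j) * lam a $ i $ j)" for i j
    by (simp add: bilin_def inner_complex_def dinner_swap[of j i])
  then show ?thesis by (simp add: Kbil_def inner_vec_def)
qed

lemma bilin_cp_trafo: "bilin (cp_trafo U Phi) = cp_refl U (bilin Phi)"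
proof -
  define X :: "complex^2^'a" where "X = (\<chi> i \<alpha>. cnj (Phi$i$\<alpha>))"
  define dag where "dag Y = (\<chi> \<alpha> j. cnj (Y$j$\<alpha>))" for Y :: "complex^2^'a"
  have bil: "bilin Y = Y ** dag Y" for Y :: "complex^2^'a"
    by (simp add: bilin_def dag_def dinner_def matrix_matrix_mult_def vec_eq_iff mult.commute)
  have "cp_trafo U Phi = U ** X"
    by (simp add: cp_trafo_def X_def matrix_matrix_mult_def vec_eq_iff)
  moreover have "dag (U ** X) = dag X ** adjoint_mat U"
    by (simp add: dag_def matrix_matrix_mult_def vec_eq_iff mult.commute)
  moreover have "conj_mat (bilin Phi) = X ** dag X"
    by (simp add: bilin_def dag_def X_def dinner_def matrix_matrix_mult_def vec_eq_iff mult.commute)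
  ultimately show ?thesis by (simp add: bil cp_refl_def matrix_mul_assoc)
qed

lemma cp_trafo_involutive_iff:
  fixes U :: "complex^'n::finite^'n"
  shows "(\<forall>Phi. cp_trafo U (cp_trafo U Phi) = Phi) \<longleftrightarrow> U ** conj_mat U = mat 1"
proof -
  have cp: "cp_trafo U (cp_trafo U Phi) = (U ** conj_mat U) ** Phi" for Phi
  proof -
    have "cp_trafo U (cp_trafo U Phi) = U ** (conj_mat U ** Phi)"
      by (simp add: cp_trafo_def matrix_matrix_mult_def vec_eq_iff)
    then show ?thesis by (simp add: matrix_mul_assoc)
  qed
  have "X = mat 1" if X: "\<forall>Phi::complex^2^'n. X ** Phi = Phi" for X :: "complex^'n^'n"
  proof -
    have "X $ i $ k = mat 1 $ i $ k" for i k
    proof -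
      \<comment> \<open>Both SU(2) components are the k-th unit vector, so applying \<open>X\<close>
        reads off its column k.\<close>
      define Phi :: "complex^2^'n" where "Phi = (\<chi> l \<alpha>. if l = k then 1 else 0)"
      have "X $ i $ l * Phi $ l $ 1 = (if l = k then X $ i $ k else 0)" for l
        by (simp add: Phi_def)
      then have "(X ** Phi) $ i $ 1 = X $ i $ k"
        by (simp add: matrix_matrix_mult_def)
      moreover have "Phi $ i $ 1 = mat 1 $ i $ k" by (simp add: Phi_def mat_def)
      ultimately show ?thesis using X by simp
    qed
    then show ?thesis by (simp add: vec_eq_iff)
  qed
  then show ?thesis by (auto simp: cp)
qed

text \<open>Polarisation: expanding \<open>outer (x + y)\<close> leaves the two mixed terms, which
  are adjoint to each other and so pair equally with the Hermitian \<open>A\<close>. Both pairings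
  therefore vanish.\<close>

lemma herm_eq_0_if_orthogonal_outer:
  fixes A :: "complex^'n::finite^'n"
  assumes A: "A \<in> herm_space" and 0: "\<And>x. A \<bullet> outer x = 0"
  shows "A = 0"
proof -
  define R where "R x y = (\<chi> i j. x$i * cnj (y$j))" for x y :: "complex^'n"
  have "outer (x + y) = outer x + outer y + (R x y + R y x)" for x y :: "complex^'n"
    by (simp add: outer_def R_def vec_eq_iff algebra_simps)
  then have "A \<bullet> (R x y + R y x) = 0" for x y
    using 0 by (metis add.right_neutral inner_add_right add_0)
  moreover have "A \<bullet> R y x = A \<bullet> R x y" for x y
  proof -
    have "adjoint_mat (R x y) = R y x" by (simp add: R_def vec_eq_iff)
    then show ?thesis using A inner_adjoint_mat[of A "R x y"] by (simp add: herm_space_def)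
  qed
  ultimately have R0: "A \<bullet> R x y = 0" for x y
    by (metis inner_add_right double_zero)
  have "A $ i $ j = 0" for i j
  proof -
    \<comment> \<open>Scaling the unit vector by the entry itself yields its squared modulus, so
      real and imaginary parts vanish at once.\<close>
    have "A $ k $ l \<bullet> R (axis i (A $ i $ j)) (axis j 1) $ k $ l
        = (if l = j then if k = i then A $ i $ j \<bullet> A $ i $ j else 0 else 0)" for k l
      by (simp add: R_def axis_def)
    then have "A \<bullet> R (axis i (A $ i $ j)) (axis j 1) = A $ i $ j \<bullet> A $ i $ j"
      by (simp add: inner_vec_def)
    then show ?thesis using R0 by simp
  qed
  then show ?thesis by (simp add: vec_eq_iff)
qed

lemma herm_space_subset_span_outer: "herm_space \<subseteq> span (range outer)"
proof
  fix A :: "complex^'n::finite^'n" assume A: "A \<in> herm_space"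
  obtain s z where s: "s \<in> span (range outer)" and z: "\<And>w. w \<in> span (range outer) \<Longrightarrow> orthogonal z w"
    and Asz: "A = s + z"
    using orthogonal_subspace_decomp_exists[of "range outer" A] by blast
  have "span (range outer) \<subseteq> (herm_space :: (complex^'n^'n) set)"
    by (rule span_minimal[OF _ subspace_herm_space])
      (auto simp: herm_space_def outer_def vec_eq_iff)
  then have "z \<in> herm_space"
    using A s Asz subspace_diff[OF subspace_herm_space, of A s] by auto
  moreover have "z \<bullet> outer x = 0" for x
    using z[of "outer x"] by (simp add: orthogonal_def span_base)
  ultimately have "z = 0" by (rule herm_eq_0_if_orthogonal_outer)
  then show "A \<in> span (range outer)" using s Asz by simp
qed

text \<open>Doublets only produce matrices of rank at most 2, but these already separate quadratic forms:
  the value on \<open>x x\<^sup>\<dagger> + y y\<^sup>\<dagger>\<close> gives the polar form at a pair of rank one matrices.\<close>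
lemma quadratic_form_vanishes_on_bilin:
  fixes D :: "complex^'n::finite^'n \<Rightarrow> complex^'n^'n \<Rightarrow> real"
  assumes lin: "\<And>A. linear (D A)" and sym: "\<And>A C. D A C = D C A"
    and 0: "\<And>Phi. D (bilin Phi) (bilin Phi) = 0"
    and A: "A \<in> herm_space" and C: "C \<in> herm_space"
  shows "D A C = 0"
proof -
  have addr: "D A (B + C) = D A B + D A C" for A B C by (rule linear_add[OF lin])
  have addl: "D (B + C) A = D B A + D C A" for A B C using addr sym by metis
  have xy: "D (outer x + outer y) (outer x + outer y) = 0" for x y
    using 0[of "\<chi> i \<alpha>. if \<alpha> = 1 then x$i else y$i"] by (simp add: bilin_columns)
  have o0: "outer 0 = (0 :: complex^'n^'n)" by (simp add: outer_def vec_eq_iff)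
  have xx: "D (outer x) (outer x) = 0" for x using xy[of x 0] by (simp add: o0)
  have "D (outer x) (outer y) = 0" for x y
    using xy[of x y] xx sym[of "outer x" "outer y"] by (simp add: addr addl)
  then have "D (outer x) C = 0" for x
    using linear_eq_0_on_span[OF lin, of "range outer"] herm_space_subset_span_outer C by blast
  then have "D C (outer x) = 0" for x using sym by metis
  then have "D C A = 0"
    using linear_eq_0_on_span[OF lin, of "range outer"] herm_space_subset_span_outer A by blast
  then show ?thesis using sym by metis
qed

section \<open>Invariance of the potential in terms of an operator on matrices\<close>

context gell_mann_basis
begin

definition gen_comb :: "(nat \<Rightarrow> real) \<Rightarrow> complex^'n^'n" where
  "gen_comb c = (\<Sum>a<nG TYPE('n). c a *\<^sub>R lam a)"

text \<open>Normalised so that \<open>P \<bullet> Lam_op Lam P\<close> is the term quadratic in the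
  \<open>K\<^sub>a\<close>. Since the generators have squared norm 2, it acts on coefficient vectors
  as twice \<open>Lam\<close>.\<close>

definition Lam_op :: "(nat \<Rightarrow> nat \<Rightarrow> real) \<Rightarrow> complex^'n^'n \<Rightarrow> complex^'n^'n" where
  "Lam_op Lam A = gen_comb (\<lambda>a. \<Sum>b<nG TYPE('n). Lam a b * (lam b \<bullet> A))"

lemma gen_comb_herm: "gen_comb c \<in> herm_space"
  unfolding gen_comb_def
  by (intro subspace_sum subspace_herm_space subspace_scale) (simp_all add: lam_herm)

lemma gen_comb_inner: "gen_comb c \<bullet> A = (\<Sum>a<nG TYPE('n). c a * (lam a \<bullet> A))"
  by (simp add: gen_comb_def inner_sum_left)

lemma gen_comb_traceless: "mat 1 \<bullet> gen_comb c = 0"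
  unfolding inner_commute[of "mat 1"] gen_comb_inner
  by (simp add: lam_inner_one inner_commute[of _ "mat 1"])

lemma lam_inner_gen_comb:
  assumes "a < nG TYPE('n)" shows "lam a \<bullet> gen_comb c = 2 * c a"
proof -
  have "c b * (lam b \<bullet> lam a) = (if b = a then 2 * c a else 0)" if "b < nG TYPE('n)" for b
    using lam_inner[OF that assms] by simp
  then show ?thesis using assms by (simp add: inner_commute[of "lam a"] gen_comb_inner)
qed

lemma gen_comb_inner_gen_comb: "gen_comb c \<bullet> gen_comb d = 2 * (\<Sum>a<nG TYPE('n). c a * d a)"
  by (simp add: gen_comb_inner lam_inner_gen_comb sum_distrib_left mult_ac)

lemma gen_comb_expansion:
  assumes "A \<in> herm_space" "mat 1 \<bullet> A = 0"
  shows "A = gen_comb (\<lambda>a. (lam a \<bullet> A) / 2)"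
proof -
  have "A - gen_comb (\<lambda>a. (lam a \<bullet> A) / 2) = 0"
    using assms subspace_diff[OF subspace_herm_space assms(1) gen_comb_herm]
    by (intro herm_eq_0) (simp_all add: inner_diff_right gen_comb_traceless lam_inner_gen_comb)
  then show ?thesis by simp
qed

lemma gen_comb_eq_iff: "gen_comb c = gen_comb d \<longleftrightarrow> (\<forall>a<nG TYPE('n). c a = d a)"
proof
  assume "gen_comb c = gen_comb d"
  then show "\<forall>a<nG TYPE('n). c a = d a"
    using lam_inner_gen_comb by (metis mult_cancel_left zero_neq_numeral)
qed (simp add: gen_comb_def)

lemma gen_comb_scaleR: "\<mu> *\<^sub>R gen_comb c = gen_comb (\<lambda>a. \<mu> * c a)"
  by (simp add: gen_comb_def scaleR_sum_right)

lemma gen_comb_sum: "(\<Sum>i\<in>I. gen_comb (c i)) = gen_comb (\<lambda>a. \<Sum>i\<in>I. c i a)"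
  unfolding gen_comb_def scaleR_sum_left by (rule sum.swap)

lemma linear_Lam_op: "linear (Lam_op Lam)"
proof (rule linearI)
  fix A B :: "complex^'n^'n" and r :: real
  show "Lam_op Lam (A + B) = Lam_op Lam A + Lam_op Lam B"
    by (simp add: Lam_op_def gen_comb_def inner_add_right distrib_left sum.distrib scaleR_add_left)
  show "Lam_op Lam (r *\<^sub>R A) = r *\<^sub>R Lam_op Lam A"
    by (simp add: Lam_op_def gen_comb_scaleR sum_distrib_left mult_ac)
qed

lemma Lam_op_inner:
  "Lam_op Lam A \<bullet> B = (\<Sum>a<nG TYPE('n). \<Sum>b<nG TYPE('n). Lam a b * (lam a \<bullet> B) * (lam b \<bullet> A))"
  by (simp add: Lam_op_def gen_comb_inner sum_distrib_left sum_distrib_right mult_ac)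

lemma Lam_op_selfadjoint:
  assumes "\<forall>a<nG TYPE('n). \<forall>b<nG TYPE('n). Lam a b = Lam b a"
  shows "Lam_op Lam A \<bullet> B = A \<bullet> Lam_op Lam B"
  unfolding Lam_op_inner inner_commute[of A]
  by (subst sum.swap) (use assms in \<open>auto intro!: sum.cong simp: mult_ac\<close>)

lemma Lam_op_gen_comb:
  "Lam_op Lam (gen_comb v) = gen_comb (\<lambda>a. 2 * (\<Sum>b<nG TYPE('n). Lam a b * v b))"
  by (simp add: Lam_op_def gen_comb_eq_iff lam_inner_gen_comb sum_distrib_left mult_ac)

lemma Lam_op_one: "Lam_op Lam (mat 1) = 0"
  by (simp add: Lam_op_def gen_comb_def lam_inner_one inner_commute[of _ "mat 1"])

lemma potential_eq:
  "potential lam M0 M Lam0 L Lam Phi =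
     (M0 * (mat 1 \<bullet> bilin Phi) + gen_comb M \<bullet> bilin Phi) +
     (Lam0 * (mat 1 \<bullet> bilin Phi)\<^sup>2 + (mat 1 \<bullet> bilin Phi) * (gen_comb L \<bullet> bilin Phi)
      + bilin Phi \<bullet> Lam_op Lam (bilin Phi))"
  unfolding potential_def K0_eq_inner Kbil_eq_inner inner_commute[of "bilin Phi" "Lam_op Lam _"]
    Lam_op_inner gen_comb_inner
  by (simp add: sum_distrib_left mult_ac)

lemma cp_odd_traceless:
  assumes "cp2_mat U" "A \<in> cp_odd U" shows "mat 1 \<bullet> A = 0"
  using cp_refl_fixed_iff[OF assms(1), of "mat 1"] cp_refl_one[OF assms(1)] assms(2)
  by (simp add: herm_space_def)

text \<open>Split \<open>P\<close> into its even part \<open>E\<close> and odd part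
  \<open>Q\<close>. The reflection only changes the sign of \<open>Q\<close>, and the cross terms of
  the quadratic form vanish because the operator is self-adjoint and keeps odd matrices odd.\<close>

lemma potential_cp_invariant:
  fixes U :: "complex^'n^'n"
  assumes sym: "\<forall>a<nG TYPE('n). \<forall>b<nG TYPE('n). Lam a b = Lam b a"
    and U: "cp2_mat U" and L: "cp_refl U (gen_comb L) = gen_comb L"
    and M: "cp_refl U (gen_comb M) = gen_comb M"
    and odd: "\<And>A. A \<in> cp_odd U \<Longrightarrow> Lam_op Lam A \<in> cp_odd U"
  shows "potential lam M0 M Lam0 L Lam (cp_trafo U Phi) = potential lam M0 M Lam0 L Lam Phi"
proof -
  let ?\<sigma> = "cp_refl U"
  define P where "P = bilin Phi"
  have P: "P \<in> herm_space" by (simp add: P_def bilin_herm)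
  define E where "E = (1/2) *\<^sub>R (P + ?\<sigma> P)"
  define Q where "Q = (1/2) *\<^sub>R (P - ?\<sigma> P)"
  have PEQ: "P = E + Q" "?\<sigma> P = E - Q"
    by (simp_all add: E_def Q_def algebra_simps flip: scaleR_add_left)
  have "E \<in> herm_space" "Q \<in> herm_space" unfolding E_def Q_def
    using P cp_refl_herm[OF P, of U] subspace_herm_space
    by (auto intro: subspace_scale subspace_add subspace_diff)
  moreover have "?\<sigma> E = E" "?\<sigma> Q = - Q"
    by (simp_all add: E_def Q_def cp_refl_linear_simps cp_refl_cp_refl[OF U] algebra_simps)
  ultimately have "Q \<in> cp_odd U" "\<forall>B\<in>cp_odd U. E \<bullet> B = 0"
    using cp_refl_fixed_iff[OF U, of E] unfolding cp_odd_def by blast+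
  then have EQ: "E \<bullet> Lam_op Lam Q = 0" using odd by blast
  then have QE: "Q \<bullet> Lam_op Lam E = 0"
    by (metis Lam_op_selfadjoint[OF sym] inner_commute)
  have "?\<sigma> P \<bullet> Lam_op Lam (?\<sigma> P) = P \<bullet> Lam_op Lam P"
    unfolding PEQ(2) unfolding PEQ(1) by (simp add: linear_add[OF linear_Lam_op] linear_diff[OF linear_Lam_op] EQ QE
        inner_add_left inner_add_right inner_diff_left inner_diff_right)
  moreover have "mat 1 \<bullet> ?\<sigma> P = mat 1 \<bullet> P" "gen_comb L \<bullet> ?\<sigma> P = gen_comb L \<bullet> P"
      "gen_comb M \<bullet> ?\<sigma> P = gen_comb M \<bullet> P"
    by (simp_all add: L M cp_refl_one[OF U] flip: cp_refl_inner[OF U])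
  ultimately show ?thesis
    unfolding potential_eq bilin_cp_trafo P_def[symmetric] by simp
qed

text \<open>Rescaling the doublets separates degrees 2 and 4. The quartic part is polarised to a
  form on all Hermitian matrices; evaluating it at the identity isolates L, and at odd matrices
  \<Lambda>.\<close>

lemma potential_cp_invariantD:
  fixes U :: "complex^'n^'n"
  assumes sym: "\<forall>a<nG TYPE('n). \<forall>b<nG TYPE('n). Lam a b = Lam b a"
    and U: "cp2_mat U"
    and inv: "\<And>Phi. potential lam M0 M Lam0 L Lam (cp_trafo U Phi) = potential lam M0 M Lam0 L Lam Phi"
  shows "cp_refl U (gen_comb L) = gen_comb L" "cp_refl U (gen_comb M) = gen_comb M"
    and "A \<in> cp_odd U \<Longrightarrow> Lam_op Lam A \<in> cp_odd U"
proof -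
  let ?\<sigma> = "cp_refl U" and ?\<Lambda> = "Lam_op Lam" and ?L = "gen_comb L" and ?M = "gen_comb M"
  have one: "mat 1 \<bullet> ?\<sigma> A = mat 1 \<bullet> A" for A
    by (simp add: cp_refl_one[OF U] flip: cp_refl_inner[OF U])
  \<comment> \<open>The \<open>M0\<close> and \<open>Lam0\<close> terms are left out: they depend
    only on the trace, which the reflection preserves.\<close>
  define quad where "quad P = (mat 1 \<bullet> P) * (?L \<bullet> P) + P \<bullet> ?\<Lambda> P" for P
  have inv_t: "t\<^sup>2 * (?M \<bullet> ?\<sigma> (bilin Phi)) + t^4 * quad (?\<sigma> (bilin Phi))
      = t\<^sup>2 * (?M \<bullet> bilin Phi) + t^4 * quad (bilin Phi)" for t Phi
  proof -
    define r where "r = t\<^sup>2"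
    have "t^4 = r * r" by (simp add: r_def flip: power_add)
    then show ?thesis
      using inv[of "t *\<^sub>R Phi"] unfolding r_def[symmetric]
      by (simp add: potential_eq bilin_cp_trafo bilin_scaleR cp_refl_linear_simps one quad_def
          linear_cmul[OF linear_Lam_op] r_def[symmetric] algebra_simps)
  qed
  have lin: "?M \<bullet> ?\<sigma> (bilin Phi) = ?M \<bullet> bilin Phi"
    and quad: "quad (?\<sigma> (bilin Phi)) = quad (bilin Phi)" for Phi
    \<comment> \<open>The values 1 and 2 give independent linear equations for the two
      degrees.\<close>
    using inv_t[of 1 Phi] inv_t[of 2 Phi] by simp_all
  have "outer x = bilin (\<chi> i \<alpha>. if \<alpha> = 1 then x$i else 0 $ i)" for x :: "complex^'n"
    unfolding bilin_columns by (simp add: outer_def vec_eq_iff)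
  then have "(?\<sigma> ?M - ?M) \<bullet> outer x = 0" for x
    using lin by (simp add: inner_diff_left cp_refl_inner[OF U])
  moreover have "?\<sigma> ?M - ?M \<in> herm_space"
    using gen_comb_herm cp_refl_herm subspace_diff[OF subspace_herm_space] by blast
  ultimately show "?\<sigma> ?M = ?M" using herm_eq_0_if_orthogonal_outer by fastforce
  define B where "B A C = ((mat 1 \<bullet> A) * (?L \<bullet> C) + (mat 1 \<bullet> C) * (?L \<bullet> A)) / 2 + A \<bullet> ?\<Lambda> C" for A C
  have BB: "B P P = quad P" for P by (simp add: B_def quad_def)
  have B_sym: "B A C = B C A" for A C
    unfolding B_def using Lam_op_selfadjoint[OF sym, of A C]
    by (simp add: inner_commute[of C "?\<Lambda> A"] add.commute)
  have B_lin: "linear (B A)" for A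
    by (rule linearI) (simp_all add: B_def linear_add[OF linear_Lam_op] linear_cmul[OF linear_Lam_op]
        inner_add_right field_simps)
  have D0: "B (?\<sigma> A) (?\<sigma> C) = B A C" if "A \<in> herm_space" "C \<in> herm_space" for A C
  proof -
    have "B (?\<sigma> A) (?\<sigma> C) - B A C = 0"
    proof (rule quadratic_form_vanishes_on_bilin[OF _ _ _ that])
      show "linear (\<lambda>C. B (?\<sigma> A) (?\<sigma> C) - B A C)" for A
        using linear_compose_sub[OF linear_compose[OF linear_cp_refl B_lin] B_lin]
        by (simp add: o_def)
      show "B (?\<sigma> A) (?\<sigma> C) - B A C = B (?\<sigma> C) (?\<sigma> A) - B C A" for A C
        using B_sym by metis
      show "B (?\<sigma> (bilin Phi)) (?\<sigma> (bilin Phi)) - B (bilin Phi) (bilin Phi) = 0" for Phi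
        by (simp add: BB quad)
    qed
    then show ?thesis by simp
  qed
  have Lh: "?\<sigma> ?L - ?L \<in> herm_space"
    using gen_comb_herm cp_refl_herm subspace_diff[OF subspace_herm_space] by blast
  have Ltr: "mat 1 \<bullet> (?\<sigma> ?L - ?L) = 0" by (simp add: inner_diff_right one)
  have B1: "B (mat 1) C = (mat 1 \<bullet> (mat 1 :: complex^'n^'n)) * (?L \<bullet> C) / 2" if "mat 1 \<bullet> C = 0" for C
  proof -
    have "mat 1 \<bullet> ?\<Lambda> C = 0" using Lam_op_selfadjoint[OF sym, of "mat 1" C] by (simp add: Lam_op_one)
    then show ?thesis using that by (simp add: B_def)
  qed
  have "(mat 1 :: complex^'n^'n) \<bullet> mat 1 \<noteq> 0"
    by (simp add: mat_def vec_eq_iff)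
  \<comment> \<open>On traceless \<open>C\<close> the form \<open>B (mat 1) C\<close> is a nonzero
    multiple of \<open>?L \<bullet> C\<close>, as \<open>Lam_op\<close> kills the identity. Taking
    \<open>C\<close> to be the defect \<open>?\<sigma> ?L - ?L\<close> makes its norm
    vanish.\<close>
  then have "?L \<bullet> ?\<sigma> (?\<sigma> ?L - ?L) = ?L \<bullet> (?\<sigma> ?L - ?L)"
    using D0[of "mat 1" "?\<sigma> ?L - ?L"] Lh Ltr one[of "?\<sigma> ?L - ?L"]
    by (simp add: B1 cp_refl_one[OF U] herm_space_def del: inner_eq_zero_iff)
  then have "(?\<sigma> ?L - ?L) \<bullet> (?\<sigma> ?L - ?L) = 0"
    by (simp add: cp_refl_inner[OF U] inner_diff_left)
  then show Lfix: "?\<sigma> ?L = ?L" by simp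
  assume A: "A \<in> cp_odd U"
  then have Ah: "A \<in> herm_space" and As: "?\<sigma> A = - A" and Atr: "mat 1 \<bullet> A = 0"
    using cp_odd_traceless[OF U] by (auto simp: cp_odd_def)
  \<comment> \<open>Twice the even part of \<open>?\<Lambda> A\<close>; invariance of
    \<open>B\<close> at the pair \<open>A\<close>, \<open>?X\<close> makes it orthogonal to
    itself.\<close>
  let ?X = "?\<sigma> (?\<Lambda> A) + ?\<Lambda> A"
  have \<Lambda>h: "?\<Lambda> A \<in> herm_space" by (simp add: Lam_op_def gen_comb_herm)
  have Xh: "?X \<in> herm_space"
    using cp_refl_herm[OF \<Lambda>h] \<Lambda>h subspace_add[OF subspace_herm_space] by blast
  have Xtr: "mat 1 \<bullet> ?X = 0" by (simp add: inner_add_right one Lam_op_def gen_comb_traceless)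
  have "B (?\<sigma> A) (?\<sigma> ?X) = B A ?X" by (rule D0[OF Ah Xh])
  then have "- (A \<bullet> ?\<Lambda> (?\<sigma> ?X)) = A \<bullet> ?\<Lambda> ?X"
    using Atr Xtr one[of ?X] by (simp add: B_def As)
  then have "- (?\<Lambda> A \<bullet> ?\<sigma> ?X) = ?\<Lambda> A \<bullet> ?X" by (simp only: Lam_op_selfadjoint[OF sym])
  then have "?X \<bullet> ?X = 0"
    by (simp only: inner_add_left cp_refl_inner[OF U])
  then have "?X = 0" by (simp only: inner_eq_zero_iff)
  then show "?\<Lambda> A \<in> cp_odd U" using \<Lambda>h by (simp add: cp_odd_def eq_neg_iff_add_eq_0)
qed

lemma has_CP2_iff:
  assumes sym: "\<forall>a<nG TYPE('n). \<forall>b<nG TYPE('n). Lam a b = Lam b a"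
  shows "has_CP2 lam M0 M Lam0 L Lam \<longleftrightarrow>
    (\<exists>U. cp2_mat U \<and> (\<forall>A\<in>cp_odd U. Lam_op Lam A \<in> cp_odd U \<and> gen_comb L \<bullet> A = 0 \<and> gen_comb M \<bullet> A = 0))"
  (is "_ \<longleftrightarrow> (\<exists>U. ?R U)")
proof -
  have "(unitary_mat U \<and> (\<forall>Phi. cp_trafo U (cp_trafo U Phi) = Phi) \<and>
      (\<forall>Phi. potential lam M0 M Lam0 L Lam (cp_trafo U Phi) = potential lam M0 M Lam0 L Lam Phi)) \<longleftrightarrow> ?R U"
    (is "?P U \<longleftrightarrow> _") for U
  proof
    assume "?P U"
    then have U: "cp2_mat U" and inv: "\<And>Phi. potential lam M0 M Lam0 L Lam (cp_trafo U Phi)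
        = potential lam M0 M Lam0 L Lam Phi"
      by (auto simp: cp2_mat_def cp_trafo_involutive_iff)
    show "?R U"
      using U potential_cp_invariantD[OF sym U inv] cp_refl_fixed_iff[OF U gen_comb_herm] by blast
  next
    assume R: "?R U"
    then have U: "cp2_mat U" by blast
    have "cp_refl U (gen_comb L) = gen_comb L" "cp_refl U (gen_comb M) = gen_comb M"
      using R cp_refl_fixed_iff[OF U gen_comb_herm] by blast+
    then show "?P U"
      using U R potential_cp_invariant[OF sym U]
      unfolding cp_trafo_involutive_iff cp2_mat_def by blast
  qed
  then show ?thesis unfolding has_CP2_def by blast
qed

end

section \<open>From odd spaces to eigenvectors and back\<close>

theorem theorem1:
  fixes lam :: "nat \<Rightarrow> complex^'n::finite^'n"
    and M0 Lam0 :: real and M L :: "nat \<Rightarrow> real" and Lam :: "nat \<Rightarrow> nat \<Rightarrow> real"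
  assumes N2: "CARD('n) \<ge> 2"
    and GM: "gell_mann lam"
    and sym: "\<forall>a < nG TYPE('n). \<forall>b < nG TYPE('n). Lam a b = Lam b a"
  shows "has_CP2 lam M0 M Lam0 L Lam \<longleftrightarrow>
    (\<exists>v :: nat \<Rightarrow> nat \<Rightarrow> real.
       (\<forall>a < nK TYPE('n). \<exists>\<mu>. \<forall>i < nG TYPE('n).
           (\<Sum>j < nG TYPE('n). Lam i j * v a j) = \<mu> * v a i) \<and>
       (\<forall>c :: nat \<Rightarrow> real. (\<forall>i < nG TYPE('n). (\<Sum>a < nK TYPE('n). c a * v a i) = 0)
           \<longrightarrow> (\<forall>a < nK TYPE('n). c a = 0)) \<and>
       (let W = span ((\<lambda>a. \<Sum>i < nG TYPE('n). v a i *\<^sub>R lam i) ` {..< nK TYPE('n)})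
        in (\<forall>A\<in>W. \<forall>B\<in>W. mcomm_i A B \<in> W) \<and>
           (\<exists>S S' :: complex^'n^'n. S ** S' = mat 1 \<and> S' ** S = mat 1 \<and>
              (\<lambda>A. S ** A ** S') ` W = so_herm)) \<and>
       (\<forall>a < nK TYPE('n). (\<Sum>i < nG TYPE('n). L i * v a i) = 0
                          \<and> (\<Sum>i < nG TYPE('n). M i * v a i) = 0))"
proof -
  interpret gell_mann_basis lam using GM by unfold_locales
  let ?k = "nK TYPE('n)"
  show ?thesis
    unfolding has_CP2_iff[OF sym] gen_comb_def[symmetric] Let_def
  proof (intro iffI; elim exE conjE)
    fix U :: "complex^'n^'n"
    assume U: "cp2_mat U"
      and odd: "\<forall>A\<in>cp_odd U. Lam_op Lam A \<in> cp_odd U \<and> gen_comb L \<bullet> A = 0 \<and> gen_comb M \<bullet> A = 0"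
    obtain E where E: "E \<subseteq> cp_odd U" "independent E" "span E = cp_odd U"
        "\<forall>A\<in>E. \<exists>\<mu>. Lam_op Lam A = \<mu> *\<^sub>R A"
      using selfadjoint_eigenbasis[OF linear_Lam_op Lam_op_selfadjoint[OF sym] subspace_cp_odd] odd
      by blast
    have "finite E" using E(2) by (rule independent_imp_finite)
    have "card E = ?k"
      using dim_span_eq_card_independent[OF E(2)] dim_cp_odd[OF U] dim_so_herm E(3) by simp
    then obtain w where w: "bij_betw w {..<?k} E"
      using ex_bij_betw_nat_finite[OF \<open>finite E\<close>] by (auto simp: atLeast0LessThan)
    \<comment> \<open>Coordinates of \<open>w a\<close> in the generators; the 2 is their squared
      norm.\<close>
    define v where "v a i = (lam i \<bullet> w a) / 2" for a i
    have wE: "w a \<in> E" if "a < ?k" for a using w that by (auto simp: bij_betw_def)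
    have gw: "gen_comb (v a) = w a" if "a < ?k" for a
      using gen_comb_expansion[of "w a"] wE[OF that] E(1) cp_odd_traceless[OF U]
      by (auto simp: v_def[abs_def] cp_odd_def)
    have im: "(\<lambda>a. gen_comb (v a)) ` {..<?k} = E"
      using gw w by (force simp: bij_betw_def)
    have "\<exists>\<mu>. \<forall>i<nG TYPE('n). (\<Sum>j<nG TYPE('n). Lam i j * v a j) = \<mu> * v a i" if a: "a < ?k" for a
    proof -
      obtain \<mu> where "Lam_op Lam (gen_comb (v a)) = \<mu> *\<^sub>R gen_comb (v a)"
        using E(4) wE[OF a] gw[OF a] by auto
      then have "\<forall>i<nG TYPE('n). 2 * (\<Sum>j<nG TYPE('n). Lam i j * v a j) = \<mu> * v a i"
        unfolding Lam_op_gen_comb gen_comb_scaleR gen_comb_eq_iff .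
      \<comment> \<open>Halved because \<open>Lam_op\<close> acts as twice \<open>Lam\<close> on
        coordinates; the converse direction doubles the eigenvalue.\<close>
      then show ?thesis by (intro exI[of _ "\<mu> / 2"]) auto
    qed
    moreover have "\<forall>a<?k. c a = 0" if c: "\<forall>i<nG TYPE('n). (\<Sum>a<?k. c a * v a i) = 0" for c
    proof -
      have "(\<Sum>a<?k. c a *\<^sub>R w a) = (\<Sum>a<?k. gen_comb (\<lambda>i. c a * v a i))"
        by (simp add: gw flip: gen_comb_scaleR)
      also have "\<dots> = 0" using c by (simp add: gen_comb_sum) (simp add: gen_comb_def)
      \<comment> \<open>The relation is reindexed from numbers to the matrices of \<open>E\<close>,
        where independence applies.\<close>
      finally have "(\<Sum>b\<in>E. c (inv_into {..<?k} w b) *\<^sub>R b) = 0"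
        using w by (subst sum.reindex_bij_betw[OF w, symmetric])
          (simp add: bij_betw_def inv_into_f_f)
      then have "c (inv_into {..<?k} w b) = 0" if "b \<in> E" for b
        using independentD[OF E(2) \<open>finite E\<close> subset_refl, of "\<lambda>b. c (inv_into {..<?k} w b)" b] that
        by simp
      then show ?thesis using wE w by (metis bij_betw_def inv_into_f_f lessThan_iff)
    qed
    moreover have "\<forall>A\<in>cp_odd U. \<forall>B\<in>cp_odd U. mcomm_i A B \<in> cp_odd U"
      using cp_odd_commutator[OF U] by blast
    moreover have "\<exists>S S' :: complex^'n^'n. S ** S' = mat 1 \<and> S' ** S = mat 1 \<and> (\<lambda>A. S ** A ** S') ` cp_odd U = so_herm"
    proof -
      obtain T where "unitary_mat T" "(\<lambda>A. adjoint_mat T ** A ** T) ` cp_odd U = so_herm"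
        using cp_odd_eq_conjugate_so_herm[OF U] .
      then show ?thesis unfolding unitary_mat_def
        by (intro exI[of _ "adjoint_mat T"] exI[of _ T]) blast
    qed
    moreover have "(\<Sum>i<nG TYPE('n). L i * v a i) = 0 \<and> (\<Sum>i<nG TYPE('n). M i * v a i) = 0"
      if "a < ?k" for a
      using odd wE[OF that] E(1) gw[OF that] gen_comb_inner_gen_comb[of L "v a"]
        gen_comb_inner_gen_comb[of M "v a"] by auto
    ultimately show "\<exists>v. (\<forall>a<?k. \<exists>\<mu>. \<forall>i<nG TYPE('n). (\<Sum>j<nG TYPE('n). Lam i j * v a j) = \<mu> * v a i) \<and>
        (\<forall>c. (\<forall>i<nG TYPE('n). (\<Sum>a<?k. c a * v a i) = 0) \<longrightarrow> (\<forall>a<?k. c a = 0)) \<and>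
        ((\<forall>A\<in>span ((\<lambda>a. gen_comb (v a)) ` {..<?k}). \<forall>B\<in>span ((\<lambda>a. gen_comb (v a)) ` {..<?k}).
             mcomm_i A B \<in> span ((\<lambda>a. gen_comb (v a)) ` {..<?k})) \<and>
         (\<exists>S S' :: complex^'n^'n. S ** S' = mat 1 \<and> S' ** S = mat 1 \<and>
             (\<lambda>A. S ** A ** S') ` span ((\<lambda>a. gen_comb (v a)) ` {..<?k}) = so_herm)) \<and>
        (\<forall>a<?k. (\<Sum>i<nG TYPE('n). L i * v a i) = 0 \<and> (\<Sum>i<nG TYPE('n). M i * v a i) = 0)"
      by (intro exI[of _ v]) (simp only: im E(3), blast)
  next
    fix v :: "nat \<Rightarrow> nat \<Rightarrow> real" and S S' :: "complex^'n^'n"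
    let ?W = "span ((\<lambda>a. gen_comb (v a)) ` {..<?k})"
    assume eig: "\<forall>a<?k. \<exists>\<mu>. \<forall>i<nG TYPE('n). (\<Sum>j<nG TYPE('n). Lam i j * v a j) = \<mu> * v a i"
      and S: "S ** S' = mat 1" "S' ** S = mat 1" "(\<lambda>A. S ** A ** S') ` ?W = so_herm"
      and LM: "\<forall>a<?k. (\<Sum>i<nG TYPE('n). L i * v a i) = 0 \<and> (\<Sum>i<nG TYPE('n). M i * v a i) = 0"
    \<comment> \<open>Every property needed on \<open>?W\<close> defines a subspace, so it only has
      to be checked on the generators \<open>gen_comb (v a)\<close>.\<close>
    have ind: "A \<in> T" if "A \<in> ?W" "subspace T" "\<And>a. a < ?k \<Longrightarrow> gen_comb (v a) \<in> T" for A T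
    proof -
      have "(\<lambda>a. gen_comb (v a)) ` {..<?k} \<subseteq> T" using that(3) by auto
      from span_minimal[OF this that(2)] that(1) show ?thesis by (rule subsetD)
    qed
    have orth: "subspace {A. B \<bullet> A = 0}" for B :: "complex^'n^'n"
      by (simp add: subspace_def inner_add_right)
    have "?W \<subseteq> herm_space" using ind[OF _ subspace_herm_space gen_comb_herm] by (rule subsetI)
    moreover have "mat 1 \<bullet> A = 0" if "A \<in> ?W" for A
      using ind[OF that orth[of "mat 1"]] by (simp add: gen_comb_traceless)
    ultimately obtain U where U: "cp2_mat U" "?W = cp_odd U"
      using conjugate_so_herm_imp_cp_odd[OF N2 subspace_span _ _ S dim_so_herm] by blast
    have "Lam_op Lam A \<in> ?W" if "A \<in> ?W" for A
    proof -
      have "subspace {A. Lam_op Lam A \<in> ?W}"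
        using linear_subspace_vimage[OF linear_Lam_op subspace_span] by (simp add: vimage_def)
      moreover have "Lam_op Lam (gen_comb (v a)) \<in> ?W" if a: "a < ?k" for a
      proof -
        obtain \<mu> where "\<forall>i<nG TYPE('n). (\<Sum>j<nG TYPE('n). Lam i j * v a j) = \<mu> * v a i"
          using eig a by blast
        then have "Lam_op Lam (gen_comb (v a)) = (2 * \<mu>) *\<^sub>R gen_comb (v a)"
          by (simp add: Lam_op_gen_comb gen_comb_scaleR gen_comb_eq_iff)
        then show ?thesis using a by (simp add: span_base span_scale)
      qed
      ultimately show ?thesis using ind[OF that, of "{A. Lam_op Lam A \<in> ?W}"] by simp
    qed
    moreover have "gen_comb L \<bullet> A = 0" "gen_comb M \<bullet> A = 0" if "A \<in> ?W" for A
      using ind[OF that orth[of "gen_comb L"]] ind[OF that orth[of "gen_comb M"]] LM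
      by (simp_all add: gen_comb_inner_gen_comb)
    ultimately show "\<exists>U. cp2_mat U \<and> (\<forall>A\<in>cp_odd U. Lam_op Lam A \<in> cp_odd U \<and>
        gen_comb L \<bullet> A = 0 \<and> gen_comb M \<bullet> A = 0)"
      unfolding U(2) using U(1) by blast
  qed
qed

end
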